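(* Let $\mathbf{k}$ be a field, $\mathcal{C}$ a Karoubian $\mathbf{k}$-linear symmetric monoidal category with $\mathrm{End}(\mathbf 1)=\mathbf{k}$, and $A$ a commutative Frobenius algebra object in $\mathcal{C}$ with handle morphism $x_0\in A_1=\mathrm{Hom}(\mathbf 1,A)$. Assume the unital subalgebra $A_0\subset A_1$ generated by $x_0$ is finite-dimensional, and let $U(T)\in\mathbf{k}[T]$ be the monic minimal polynomial of $x_0$. Let $U(T)=U_1(T)U_2(T)$ be a factorization into relatively prime monic polynomials with $U_2(T)$ not divisible by $T$, choose $a(T),b(T)\in\mathbf{k}[T]$ with $a(T)U_1(T)+b(T)U_2(T)=1$, and let $e=a(x_0)U_1(x_0)\in A_0$ be the corresponding idempotent. Put $Q_i(T)=T^{\deg U_i}U_i(T^{-1})$ for $i=1,2$. Let $Z(T)$ be the generating function of $A$, and let $$Z(T)=Z_1(T)+Z_2(T),\qquad Z_1(T)=\frac{v_1(T)}{Q_1(T)},\quad Z_2(T)=\frac{v_2(T)}{Q_2(T)},$$ be the unique partial fraction decomposition with $v_1(T),v_2(T)$ polynomials and $\deg v_1(T)<\deg Q_1(T)$ (so $Z_1(T)$ is a proper fraction, while $Z_2(T)$ may not be proper). Then the generating functions of the commutative Frobenius algebra objects $\phi(e)A$ and $\phi(1-e)A$ are $Z_1(T)$ and $Z_2(T)$ respectively.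
   Context: A commutative Frobenius algebra in $\mathcal{C}$ is a commutative associative unital algebra object $(A,m,\iota)$ with a morphism $\epsilon:A\to\mathbf 1$ such that $\epsilon\circ m$ is a non-degenerate pairing (an evaluation map exhibiting $A$ as its own dual). $\Delta:A\to A\otimes A$ is the dual of $m$, $x=m\Delta:A\to A$ is the handle endomorphism, and $x_0=x\iota\in\mathrm{Hom}(\mathbf 1,A)$ is the handle morphism. The generating function of $A$ is $Z(T)=\sum_{n\ge0}\alpha_nT^n$ where $\epsilon x^n\iota=\alpha_n\mathrm{id}_{\mathbf 1}$. The vector space $A_1=\mathrm{Hom}(\mathbf 1,A)$ is a commutative algebra under the multiplication of $A$, and $\phi:A_1\to\mathrm{End}_{\mathcal{C}}(A)$ is the injective homomorphism given by multiplication; $\phi(x_0)=x$. Under the hypotheses $Z(T)$ is a rational function that can be written with denominator $Q(T)=T^{\deg U}U(T^{-1})=Q_1(T)Q_2(T)$, $Q(0)=1$. For an idempotent $e\in A_0$, the image $\phi(e)A$ of $\phi(e)$ is a commutative Frobenius algebra in $\mathcal{C}$ (with unit induced by $e$ and the restriction of $\epsilon$), and $A=\phi(e)A\oplus\phi(1-e)A$ as a direct sum of Frobenius algebras.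
   Formalization: The indices of Q_1, Q_2 are corrected: here Q_1(T)=T^{deg U_2}U_2(T^{-1}) and Q_2(T)=T^{deg U_1}U_1(T^{-1}), because e=a(x_0)U_1(x_0) is annihilated by U_2(x_0); as printed the claim fails, e.g. for A=k with U_1=1, U_2=T-1. *)

theory Defs
  imports
    "Jordan_Normal_Form.VS_Connect"
    "HOL-Computational_Algebra.Polynomial_FPS"
begin

section \<open>Linear symmetric monoidal categories\<close>

text \<open>
  Data of a (not necessarily strict) symmetric monoidal category enriched in vector spaces over the
  field given by the type of scalars. Composition is written in the usual order, so that
  \<open>g \<cdot> f\<close> means ``first \<open>f\<close>, then \<open>g\<close>''. The structure isomorphisms have the directions
  \<open>Assoc X Y Z : (X \<boxtimes> Y) \<boxtimes> Z \<rightarrow> X \<boxtimes> (Y \<boxtimes> Z)\<close>, \<open>Lunit X : \<I> \<boxtimes> X \<rightarrow> X\<close>,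
  \<open>Runit X : X \<boxtimes> \<I> \<rightarrow> X\<close> and \<open>Braid X Y : X \<boxtimes> Y \<rightarrow> Y \<boxtimes> X\<close>.
\<close>

record ('o, 'm, 'k) ksmc =
  Obj :: "'o set"
  Arr :: "'m set"
  Dom :: "'m \<Rightarrow> 'o"
  Cod :: "'m \<Rightarrow> 'o"
  Ident :: "'o \<Rightarrow> 'm"
  Comp :: "'m \<Rightarrow> 'm \<Rightarrow> 'm" (infixr \<open>\<cdot>\<index>\<close> 75)
  Zero :: "'o \<Rightarrow> 'o \<Rightarrow> 'm"
  Plus :: "'m \<Rightarrow> 'm \<Rightarrow> 'm"
  Scale :: "'k \<Rightarrow> 'm \<Rightarrow> 'm"
  Unit :: "'o" (\<open>\<I>\<index>\<close>)
  Tobj :: "'o \<Rightarrow> 'o \<Rightarrow> 'o" (infixr \<open>\<boxtimes>\<index>\<close> 80)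
  Tarr :: "'m \<Rightarrow> 'm \<Rightarrow> 'm" (infixr \<open>\<star>\<index>\<close> 80)
  Assoc :: "'o \<Rightarrow> 'o \<Rightarrow> 'o \<Rightarrow> 'm"
  Lunit :: "'o \<Rightarrow> 'm"
  Runit :: "'o \<Rightarrow> 'm"
  Braid :: "'o \<Rightarrow> 'o \<Rightarrow> 'm"

context
  fixes C :: "('o, 'm, 'k) ksmc" (structure)
begin

definition Hom :: "'o \<Rightarrow> 'o \<Rightarrow> 'm set" where
  "Hom X Y = {f \<in> Arr C. Dom C f = X \<and> Cod C f = Y}"

text \<open>The fields \<open>mult\<close> and \<open>one\<close> are irrelevant for the vector space structure.\<close>

definition Hom_space :: "'o \<Rightarrow> 'o \<Rightarrow> ('k, 'm) module" where
  "Hom_space X Y =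
     \<lparr>carrier = Hom X Y, monoid.mult = undefined, one = undefined,
      zero = Zero C X Y, add = Plus C, module.smult = Scale C\<rparr>"

definition inverse_arrows :: "'m \<Rightarrow> 'm \<Rightarrow> bool" where
  "inverse_arrows f g \<longleftrightarrow> f \<in> Arr C \<and> g \<in> Hom (Cod C f) (Dom C f) \<and>
     g \<cdot> f = Ident C (Dom C f) \<and> f \<cdot> g = Ident C (Cod C f)"

definition Iso :: "'o \<Rightarrow> 'o \<Rightarrow> 'm set" where
  "Iso X Y = {f \<in> Hom X Y. \<exists>g. inverse_arrows f g}"

definition inverse_arrow :: "'m \<Rightarrow> 'm" where
  "inverse_arrow f = (THE g. inverse_arrows f g)"

end

locale ksmc_category =
  fixes C :: "('o, 'm, 'k::field) ksmc" (structure)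
  assumes Dom_closed: "f \<in> Arr C \<Longrightarrow> Dom C f \<in> Obj C"
    and Cod_closed: "f \<in> Arr C \<Longrightarrow> Cod C f \<in> Obj C"
    and Ident_closed: "X \<in> Obj C \<Longrightarrow> Ident C X \<in> Hom C X X"
    and Comp_closed: "\<lbrakk>f \<in> Hom C X Y; g \<in> Hom C Y Z\<rbrakk> \<Longrightarrow> g \<cdot> f \<in> Hom C X Z"
    and Ident_left: "f \<in> Hom C X Y \<Longrightarrow> Ident C Y \<cdot> f = f"
    and Ident_right: "f \<in> Hom C X Y \<Longrightarrow> f \<cdot> Ident C X = f"
    and Comp_assoc:
      "\<lbrakk>f \<in> Hom C W X; g \<in> Hom C X Y; h \<in> Hom C Y Z\<rbrakk> \<Longrightarrow> (h \<cdot> g) \<cdot> f = h \<cdot> (g \<cdot> f)"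

locale k_linear_category = ksmc_category +
  assumes Hom_vectorspace:
      "\<lbrakk>X \<in> Obj C; Y \<in> Obj C\<rbrakk> \<Longrightarrow> vectorspace class_ring (Hom_space C X Y)"
    and Comp_Plus_left:
      "\<lbrakk>f \<in> Hom C X Y; g \<in> Hom C Y Z; g' \<in> Hom C Y Z\<rbrakk> \<Longrightarrow>
        Plus C g g' \<cdot> f = Plus C (g \<cdot> f) (g' \<cdot> f)"
    and Comp_Plus_right:
      "\<lbrakk>f \<in> Hom C X Y; f' \<in> Hom C X Y; g \<in> Hom C Y Z\<rbrakk> \<Longrightarrow>
        g \<cdot> Plus C f f' = Plus C (g \<cdot> f) (g \<cdot> f')"
    and Comp_Scale_left:
      "\<lbrakk>f \<in> Hom C X Y; g \<in> Hom C Y Z\<rbrakk> \<Longrightarrow> Scale C c g \<cdot> f = Scale C c (g \<cdot> f)"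
    and Comp_Scale_right:
      "\<lbrakk>f \<in> Hom C X Y; g \<in> Hom C Y Z\<rbrakk> \<Longrightarrow> g \<cdot> Scale C c f = Scale C c (g \<cdot> f)"

locale monoidal_category = ksmc_category +
  assumes Unit_closed: "\<I> \<in> Obj C"
    and Tobj_closed: "\<lbrakk>X \<in> Obj C; Y \<in> Obj C\<rbrakk> \<Longrightarrow> X \<boxtimes> Y \<in> Obj C"
    and Tarr_closed:
      "\<lbrakk>f \<in> Hom C X Y; f' \<in> Hom C X' Y'\<rbrakk> \<Longrightarrow> f \<star> f' \<in> Hom C (X \<boxtimes> X') (Y \<boxtimes> Y')"
    and Tarr_Ident:
      "\<lbrakk>X \<in> Obj C; Y \<in> Obj C\<rbrakk> \<Longrightarrow> Ident C X \<star> Ident C Y = Ident C (X \<boxtimes> Y)"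
    and Tarr_Comp:
      "\<lbrakk>f \<in> Hom C X Y; g \<in> Hom C Y Z; f' \<in> Hom C X' Y'; g' \<in> Hom C Y' Z'\<rbrakk> \<Longrightarrow>
        (g \<cdot> f) \<star> (g' \<cdot> f') = (g \<star> g') \<cdot> (f \<star> f')"
    and Assoc_iso:
      "\<lbrakk>X \<in> Obj C; Y \<in> Obj C; Z \<in> Obj C\<rbrakk> \<Longrightarrow>
        Assoc C X Y Z \<in> Iso C ((X \<boxtimes> Y) \<boxtimes> Z) (X \<boxtimes> (Y \<boxtimes> Z))"
    and Assoc_natural:
      "\<lbrakk>f \<in> Hom C X X'; g \<in> Hom C Y Y'; h \<in> Hom C Z Z'\<rbrakk> \<Longrightarrow>
        Assoc C X' Y' Z' \<cdot> ((f \<star> g) \<star> h) = (f \<star> (g \<star> h)) \<cdot> Assoc C X Y Z"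
    and Lunit_iso: "X \<in> Obj C \<Longrightarrow> Lunit C X \<in> Iso C (\<I> \<boxtimes> X) X"
    and Lunit_natural:
      "f \<in> Hom C X Y \<Longrightarrow> Lunit C Y \<cdot> (Ident C \<I> \<star> f) = f \<cdot> Lunit C X"
    and Runit_iso: "X \<in> Obj C \<Longrightarrow> Runit C X \<in> Iso C (X \<boxtimes> \<I>) X"
    and Runit_natural:
      "f \<in> Hom C X Y \<Longrightarrow> Runit C Y \<cdot> (f \<star> Ident C \<I>) = f \<cdot> Runit C X"
    and pentagon:
      "\<lbrakk>W \<in> Obj C; X \<in> Obj C; Y \<in> Obj C; Z \<in> Obj C\<rbrakk> \<Longrightarrow>
        Assoc C W X (Y \<boxtimes> Z) \<cdot> Assoc C (W \<boxtimes> X) Y Z =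
        (Ident C W \<star> Assoc C X Y Z) \<cdot> Assoc C W (X \<boxtimes> Y) Z \<cdot> (Assoc C W X Y \<star> Ident C Z)"
    and triangle:
      "\<lbrakk>X \<in> Obj C; Y \<in> Obj C\<rbrakk> \<Longrightarrow>
        (Ident C X \<star> Lunit C Y) \<cdot> Assoc C X \<I> Y = Runit C X \<star> Ident C Y"

locale symmetric_monoidal_category = monoidal_category +
  assumes Braid_closed:
      "\<lbrakk>X \<in> Obj C; Y \<in> Obj C\<rbrakk> \<Longrightarrow> Braid C X Y \<in> Hom C (X \<boxtimes> Y) (Y \<boxtimes> X)"
    and Braid_natural:
      "\<lbrakk>f \<in> Hom C X X'; g \<in> Hom C Y Y'\<rbrakk> \<Longrightarrow>
        Braid C X' Y' \<cdot> (f \<star> g) = (g \<star> f) \<cdot> Braid C X Y"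
    and Braid_symmetric:
      "\<lbrakk>X \<in> Obj C; Y \<in> Obj C\<rbrakk> \<Longrightarrow> Braid C Y X \<cdot> Braid C X Y = Ident C (X \<boxtimes> Y)"
    and hexagon:
      "\<lbrakk>X \<in> Obj C; Y \<in> Obj C; Z \<in> Obj C\<rbrakk> \<Longrightarrow>
        Assoc C Y Z X \<cdot> Braid C X (Y \<boxtimes> Z) \<cdot> Assoc C X Y Z =
        (Ident C Y \<star> Braid C X Z) \<cdot> Assoc C Y X Z \<cdot> (Braid C X Y \<star> Ident C Z)"

locale k_linear_symmetric_monoidal_category = k_linear_category + symmetric_monoidal_category +
  assumes Tarr_Plus_left:
      "\<lbrakk>f \<in> Hom C X Y; f' \<in> Hom C X Y; g \<in> Hom C X' Y'\<rbrakk> \<Longrightarrow>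
        Plus C f f' \<star> g = Plus C (f \<star> g) (f' \<star> g)"
    and Tarr_Plus_right:
      "\<lbrakk>f \<in> Hom C X Y; g \<in> Hom C X' Y'; g' \<in> Hom C X' Y'\<rbrakk> \<Longrightarrow>
        f \<star> Plus C g g' = Plus C (f \<star> g) (f \<star> g')"
    and Tarr_Scale_left:
      "\<lbrakk>f \<in> Hom C X Y; g \<in> Hom C X' Y'\<rbrakk> \<Longrightarrow> Scale C c f \<star> g = Scale C c (f \<star> g)"
    and Tarr_Scale_right:
      "\<lbrakk>f \<in> Hom C X Y; g \<in> Hom C X' Y'\<rbrakk> \<Longrightarrow> f \<star> Scale C c g = Scale C c (f \<star> g)"


section \<open>Images of idempotents\<close>

context
  fixes C :: "('o, 'm, 'k) ksmc" (structure)
begin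

text \<open>
  \<open>Y\<close> is the image of the idempotent \<open>p : X \<rightarrow> X\<close>, with projection \<open>r : X \<rightarrow> Y\<close> and
  inclusion \<open>s : Y \<rightarrow> X\<close>.
\<close>

definition splits :: "'o \<Rightarrow> 'm \<Rightarrow> 'o \<Rightarrow> 'm \<Rightarrow> 'm \<Rightarrow> bool" where
  "splits X p Y r s \<longleftrightarrow>
     Y \<in> Obj C \<and> r \<in> Hom C X Y \<and> s \<in> Hom C Y X \<and> s \<cdot> r = p \<and> r \<cdot> s = Ident C Y"

definition karoubian :: bool where
  "karoubian \<longleftrightarrow>
     (\<forall>X\<in>Obj C. \<forall>p\<in>Hom C X X. p \<cdot> p = p \<longrightarrow> (\<exists>Y r s. splits X p Y r s))"

definition End_unit_is_scalars :: bool where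
  "End_unit_is_scalars \<longleftrightarrow> bij_betw (\<lambda>c. Scale C c (Ident C \<I>)) UNIV (Hom C \<I> \<I>)"


section \<open>Duality\<close>

text \<open>
  \<open>ev : X' \<boxtimes> X \<rightarrow> \<I>\<close> and \<open>coev : \<I> \<rightarrow> X \<boxtimes> X'\<close> satisfy the two zigzag identities, that is,
  they exhibit \<open>X'\<close> as a dual of \<open>X\<close>.
\<close>

definition dual_pair :: "'o \<Rightarrow> 'o \<Rightarrow> 'm \<Rightarrow> 'm \<Rightarrow> bool" where
  "dual_pair X X' ev coev \<longleftrightarrow>
     X \<in> Obj C \<and> X' \<in> Obj C \<and> ev \<in> Hom C (X' \<boxtimes> X) \<I> \<and> coev \<in> Hom C \<I> (X \<boxtimes> X') \<and>
     Runit C X \<cdot> (Ident C X \<star> ev) \<cdot> Assoc C X X' X \<cdot> (coev \<star> Ident C X) = Lunit C X \<and>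
     Lunit C X' \<cdot> (ev \<star> Ident C X') \<cdot> inverse_arrow C (Assoc C X' X X') \<cdot> (Ident C X' \<star> coev)
       = Runit C X'"

text \<open>
  The dual \<open>Y' \<rightarrow> X'\<close> of \<open>f : X \<rightarrow> Y\<close>, the composite
  \<open>Y' \<rightarrow> Y' \<boxtimes> \<I> \<rightarrow> Y' \<boxtimes> (X \<boxtimes> X') \<rightarrow> Y' \<boxtimes> (Y \<boxtimes> X') \<rightarrow> (Y' \<boxtimes> Y) \<boxtimes> X' \<rightarrow> \<I> \<boxtimes> X' \<rightarrow> X'\<close>.
\<close>

definition dual_arrow :: "'o \<Rightarrow> 'm \<Rightarrow> 'o \<Rightarrow> 'o \<Rightarrow> 'm \<Rightarrow> 'm \<Rightarrow> 'm" where
  "dual_arrow X' coev_X Y Y' ev_Y f =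
     Lunit C X' \<cdot> (ev_Y \<star> Ident C X') \<cdot> inverse_arrow C (Assoc C Y' Y X') \<cdot>
     (Ident C Y' \<star> (f \<star> Ident C X')) \<cdot> (Ident C Y' \<star> coev_X) \<cdot> inverse_arrow C (Runit C Y')"

text \<open>
  Coevaluation exhibiting \<open>Y' \<boxtimes> X'\<close> as the dual of \<open>X \<boxtimes> Y\<close>, namely
  \<open>\<I> \<rightarrow> X \<boxtimes> X' \<rightarrow> X \<boxtimes> (\<I> \<boxtimes> X') \<rightarrow> X \<boxtimes> ((Y \<boxtimes> Y') \<boxtimes> X') \<rightarrow> X \<boxtimes> (Y \<boxtimes> (Y' \<boxtimes> X'))
  \<rightarrow> (X \<boxtimes> Y) \<boxtimes> (Y' \<boxtimes> X')\<close>.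
\<close>

definition tensor_coev :: "'o \<Rightarrow> 'o \<Rightarrow> 'm \<Rightarrow> 'o \<Rightarrow> 'o \<Rightarrow> 'm \<Rightarrow> 'm" where
  "tensor_coev X X' coev_X Y Y' coev_Y =
     inverse_arrow C (Assoc C X Y (Y' \<boxtimes> X')) \<cdot> (Ident C X \<star> Assoc C Y Y' X') \<cdot>
     (Ident C X \<star> (coev_Y \<star> Ident C X')) \<cdot> (Ident C X \<star> inverse_arrow C (Lunit C X')) \<cdot> coev_X"

end


section \<open>Commutative Frobenius algebras\<close>

record ('o, 'm) frobenius_data =
  Fobj :: "'o"
  Fmult :: "'m"
  Funit :: "'m"
  Fcounit :: "'m"

context
  fixes C :: "('o, 'm, 'k) ksmc" (structure) and A :: "('o, 'm) frobenius_data"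
begin

definition commutative_algebra_object :: bool where
  "commutative_algebra_object \<longleftrightarrow>
     (let X = Fobj A; m = Fmult A; u = Funit A in
       X \<in> Obj C \<and> m \<in> Hom C (X \<boxtimes> X) X \<and> u \<in> Hom C \<I> X \<and>
       m \<cdot> (m \<star> Ident C X) = m \<cdot> (Ident C X \<star> m) \<cdot> Assoc C X X X \<and>
       m \<cdot> (u \<star> Ident C X) = Lunit C X \<and>
       m \<cdot> (Ident C X \<star> u) = Runit C X \<and>
       m \<cdot> Braid C X X = m)"

definition Fpairing :: 'm where
  "Fpairing = Fcounit A \<cdot> Fmult A"

definition commutative_frobenius_algebra :: bool where
  "commutative_frobenius_algebra \<longleftrightarrow>
     commutative_algebra_object \<and> Fcounit A \<in> Hom C (Fobj A) \<I> \<and>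
     (\<exists>c. dual_pair C (Fobj A) (Fobj A) Fpairing c)"

text \<open>The pairing determines its copairing uniquely.\<close>

definition Fcopairing :: 'm where
  "Fcopairing = (THE c. dual_pair C (Fobj A) (Fobj A) Fpairing c)"

definition Fcomult :: 'm where
  "Fcomult =
     (let X = Fobj A in
       dual_arrow C (X \<boxtimes> X) (tensor_coev C X X Fcopairing X X Fcopairing) X X Fpairing (Fmult A))"

definition handle_endo :: 'm where
  "handle_endo = Fmult A \<cdot> Fcomult"

definition handle :: 'm where
  "handle = handle_endo \<cdot> Funit A"

definition gen_fun :: "'k fps" where
  "gen_fun = Abs_fps (\<lambda>n. THE c.
     Fcounit A \<cdot> (((\<lambda>g. handle_endo \<cdot> g) ^^ n) (Ident C (Fobj A))) \<cdot> Funit A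
       = Scale C c (Ident C \<I>))"

text \<open>The algebra \<open>Hom(\<I>, A)\<close> and its action on \<open>A\<close> by multiplication.\<close>

definition point_alg :: "('k, 'm) module" where
  "point_alg =
     \<lparr>carrier = Hom C \<I> (Fobj A),
      monoid.mult = (\<lambda>f g. Fmult A \<cdot> (f \<star> g) \<cdot> inverse_arrow C (Lunit C \<I>)),
      one = Funit A,
      zero = Zero C \<I> (Fobj A), add = Plus C, module.smult = Scale C\<rparr>"

definition mult_by :: "'m \<Rightarrow> 'm" where
  "mult_by f = Fmult A \<cdot> (f \<star> Ident C (Fobj A)) \<cdot> inverse_arrow C (Lunit C (Fobj A))"

text \<open>
  For an idempotent \<open>e : \<I> \<rightarrow> A\<close> and a splitting of \<open>mult_by e\<close> with image \<open>B\<close>, the structure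
  that \<open>A\<close> induces on \<open>B\<close>; its unit is \<open>e\<close> itself, corestricted to \<open>B\<close>.
  Beware of the indices: if \<open>U1 * U2\<close> annihilates the handle \<open>x0\<close> and \<open>e = a(x0) U1(x0)\<close>, then it is
  \<open>U2\<close> that annihilates the handle endomorphism of the summand cut out by \<open>e\<close>, so the generating
  function of that summand has denominator \<open>reflect_poly U2\<close>, where
  \<open>reflect_poly P = T ^ degree P * P(1/T)\<close>.
\<close>

definition summand :: "'m \<Rightarrow> 'o \<Rightarrow> 'm \<Rightarrow> 'm \<Rightarrow> ('o, 'm) frobenius_data" where
  "summand e B r s =
     \<lparr>Fobj = B, Fmult = r \<cdot> Fmult A \<cdot> (s \<star> s), Funit = r \<cdot> e, Fcounit = Fcounit A \<cdot> s\<rparr>"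

end


section \<open>Subalgebras and minimal polynomials\<close>

inductive_set generated_subalgebra :: "('k, 'm) module \<Rightarrow> 'm set \<Rightarrow> 'm set"
  for M :: "('k, 'm) module" and S :: "'m set" where
  incl: "x \<in> S \<Longrightarrow> x \<in> generated_subalgebra M S"
| one: "\<one>\<^bsub>M\<^esub> \<in> generated_subalgebra M S"
| zero: "\<zero>\<^bsub>M\<^esub> \<in> generated_subalgebra M S"
| add: "\<lbrakk>x \<in> generated_subalgebra M S; y \<in> generated_subalgebra M S\<rbrakk> \<Longrightarrow>
    x \<oplus>\<^bsub>M\<^esub> y \<in> generated_subalgebra M S"
| mult: "\<lbrakk>x \<in> generated_subalgebra M S; y \<in> generated_subalgebra M S\<rbrakk> \<Longrightarrow>
    x \<otimes>\<^bsub>M\<^esub> y \<in> generated_subalgebra M S"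
| smult: "x \<in> generated_subalgebra M S \<Longrightarrow> c \<odot>\<^bsub>M\<^esub> x \<in> generated_subalgebra M S"

definition poly_eval :: "('k::field, 'm) module \<Rightarrow> 'k poly \<Rightarrow> 'm \<Rightarrow> 'm" where
  "poly_eval M p x = (\<Oplus>\<^bsub>M\<^esub>i\<in>{..degree p}. coeff p i \<odot>\<^bsub>M\<^esub> (x [^]\<^bsub>M\<^esub> i))"

definition is_min_poly :: "('k::field, 'm) module \<Rightarrow> 'm \<Rightarrow> 'k poly \<Rightarrow> bool" where
  "is_min_poly M x U \<longleftrightarrow>
     lead_coeff U = 1 \<and> poly_eval M U x = \<zero>\<^bsub>M\<^esub> \<and>
     (\<forall>p. p \<noteq> 0 \<and> poly_eval M p x = \<zero>\<^bsub>M\<^esub> \<longrightarrow> degree U \<le> degree p)"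


section \<open>Partial fractions\<close>

text \<open>
  \<open>Z = v1 / Q1 + v2 / Q2\<close> with the first fraction proper; the degree of the zero polynomial counts
  as \<open>-\<infinity>\<close>. Division is that of power series, so it is meant for \<open>Q1\<close> and \<open>Q2\<close> with nonzero
  constant term.
\<close>

definition partial_fractions ::
    "'k::field fps \<Rightarrow> 'k poly \<Rightarrow> 'k poly \<Rightarrow> 'k poly \<Rightarrow> 'k poly \<Rightarrow> bool" where
  "partial_fractions Z Q1 Q2 v1 v2 \<longleftrightarrow>
     Z = fps_of_poly v1 / fps_of_poly Q1 + fps_of_poly v2 / fps_of_poly Q2 \<and>
     (v1 = 0 \<or> degree v1 < degree Q1)"

end

theory Submission
  imports Defs
begin

text \<open>
  An endomorphism \<open>t\<close> of \<open>A\<close> with \<open>t m = m (t \<otimes> 1)\<close> is determined by \<open>t \<iota>\<close>, and these module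
  endomorphisms form a commutative algebra, which multiplication identifies with \<open>Hom(\<I>, A)\<close>.
  The Frobenius relation \<open>\<Delta> = (m \<otimes> 1)(1 \<otimes> coev)\<close> shows that the handle endomorphism \<open>x\<close> is one
  of them, so every polynomial in \<open>x\<^sub>0\<close> acts on \<open>A\<close> as the same polynomial in \<open>x\<close>.
  If \<open>p = s r\<close> is a split idempotent of this kind, \<open>(r \<otimes> r) coev\<close> is a copairing for the
  image and its handle endomorphism is \<open>r x s\<close>. Hence the generating function of the
  summand cut out by \<open>e = g(x\<^sub>0)\<close> has coefficients \<open>L(T\<^sup>n g)\<close> for the linear functional
  \<open>L(q) = \<epsilon> q(x\<^sub>0)\<close>, which vanishes on multiples of \<open>U\<close>. For \<open>g = a U\<^sub>1\<close> and \<open>g = b U\<^sub>2\<close> this is a linear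
  recurrence with characteristic polynomial \<open>U\<^sub>2\<close> and \<open>U\<^sub>1\<close> respectively, hence a fraction with the
  reversed polynomial as denominator, proper in the first case because \<open>U\<^sub>2(0) \<noteq> 0\<close>. As the two series
  add up to \<open>Z\<close>, uniqueness of partial fractions concludes.
\<close>

section \<open>Coherence and duality in monoidal categories\<close>

context ksmc_category
begin

lemma arr_Dom [simp]: "f \<in> Arr C \<Longrightarrow> Dom C f \<in> Obj C"
  and arr_Cod [simp]: "f \<in> Arr C \<Longrightarrow> Cod C f \<in> Obj C"
  by (fact Dom_closed Cod_closed)+

lemma Ident_simps [simp]:
  assumes "X \<in> Obj C"
  shows "Ident C X \<in> Arr C" "Dom C (Ident C X) = X" "Cod C (Ident C X) = X"
  using Ident_closed[OF assms] by (simp_all add: Hom_def)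

text \<open>Typing through \<open>Arr\<close>, \<open>Dom\<close> and \<open>Cod\<close> instead of
  \<open>Hom\<close> leaves only equations between computed objects as side conditions, so the
  simplifier can type composites by itself.\<close>

lemma Comp_simps [simp]:
  assumes "f \<in> Arr C" "g \<in> Arr C" "Cod C f = Dom C g"
  shows "g \<cdot> f \<in> Arr C" "Dom C (g \<cdot> f) = Dom C f" "Cod C (g \<cdot> f) = Cod C g"
  using Comp_closed[of f "Dom C f" "Cod C f" g "Cod C g"] assms by (simp_all add: Hom_def)

lemma Comp_assoc' [simp]:
  assumes "f \<in> Arr C" "g \<in> Arr C" "h \<in> Arr C" "Cod C f = Dom C g" "Cod C g = Dom C h"
  shows "(h \<cdot> g) \<cdot> f = h \<cdot> (g \<cdot> f)"
  using Comp_assoc[of f "Dom C f" "Cod C f" g "Cod C g" h "Cod C h"] assms by (simp add: Hom_def)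

lemma Ident_left' [simp]: "f \<in> Arr C \<Longrightarrow> Cod C f = X \<Longrightarrow> Ident C X \<cdot> f = f"
  and Ident_right' [simp]: "f \<in> Arr C \<Longrightarrow> Dom C f = X \<Longrightarrow> f \<cdot> Ident C X = f"
  using Ident_left[of f "Dom C f" "Cod C f"] Ident_right[of f "Dom C f" "Cod C f"]
  by (auto simp: Hom_def)

lemma inverse_arrows_unique:
  assumes "inverse_arrows C f g" "inverse_arrows C f g'"
  shows "g = g'"
proof -
  have "g = (g' \<cdot> f) \<cdot> g" using assms by (simp add: inverse_arrows_def Hom_def)
  also have "\<dots> = g' \<cdot> (f \<cdot> g)" using assms
    by (intro Comp_assoc') (auto simp add: inverse_arrows_def Hom_def)
  also have "\<dots> = g'" using assms by (simp add: inverse_arrows_def Hom_def)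
  finally show ?thesis .
qed

lemma Iso_simps:
  assumes "f \<in> Iso C X Y"
  shows "f \<in> Arr C" "Dom C f = X" "Cod C f = Y"
    and "inverse_arrow C f \<in> Arr C" "Dom C (inverse_arrow C f) = Y" "Cod C (inverse_arrow C f) = X"
    and "inverse_arrow C f \<cdot> f = Ident C X" "f \<cdot> inverse_arrow C f = Ident C Y"
proof -
  obtain g where g: "inverse_arrows C f g" and f: "f \<in> Hom C X Y"
    using assms by (auto simp: Iso_def)
  have "inverse_arrow C f = g"
    unfolding inverse_arrow_def using g inverse_arrows_unique by blast
  then show "f \<in> Arr C" "Dom C f = X" "Cod C f = Y"
    and "inverse_arrow C f \<in> Arr C" "Dom C (inverse_arrow C f) = Y" "Cod C (inverse_arrow C f) = X"
    and "inverse_arrow C f \<cdot> f = Ident C X" "f \<cdot> inverse_arrow C f = Ident C Y"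
    using f g by (auto simp: inverse_arrows_def Hom_def)
qed

text \<open>Simplification nests composites to the right, so a cancelling pair normally has a tail
  \<open>g\<close> behind it.\<close>

lemma Iso_cancel [simp]:
  assumes "f \<in> Iso C X Y" "g \<in> Arr C"
  shows "Cod C g = X \<Longrightarrow> inverse_arrow C f \<cdot> (f \<cdot> g) = g"
    and "Cod C g = Y \<Longrightarrow> f \<cdot> (inverse_arrow C f \<cdot> g) = g"
proof -
  note f = Iso_simps[OF assms(1)]
  show "inverse_arrow C f \<cdot> (f \<cdot> g) = g" if "Cod C g = X"
    using Comp_assoc'[of g f "inverse_arrow C f"] f assms(2) that by simp
  show "f \<cdot> (inverse_arrow C f \<cdot> g) = g" if "Cod C g = Y"
    using Comp_assoc'[of g "inverse_arrow C f" f] f assms(2) that by simp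
qed

lemma Iso_right_cancel:
  assumes "f \<in> Iso C X Y" "g \<in> Arr C" "h \<in> Arr C" "Dom C g = Y" "Dom C h = Y"
    and "g \<cdot> f = h \<cdot> f"
  shows "g = h"
  using arg_cong[OF assms(6), of "\<lambda>t. t \<cdot> inverse_arrow C f"] Iso_simps[OF assms(1)] assms(2-5)
  by simp

lemma Iso_left_cancel:
  assumes "f \<in> Iso C X Y" "g \<in> Arr C" "h \<in> Arr C" "Cod C g = X" "Cod C h = X"
    and "f \<cdot> g = f \<cdot> h"
  shows "g = h"
  using Iso_cancel(1)[OF assms(1)] assms(2-) by metis

text \<open>Turns naturality squares of isomorphisms into those of their inverses, as needed for the
  inverse associators and unitors.\<close>

lemma conj_inverse:
  assumes "f \<in> Iso C X Y" "f' \<in> Iso C X' Y'" "g \<in> Arr C" "g' \<in> Arr C"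
    and "Dom C g = X" "Cod C g = X'" "Dom C g' = Y" "Cod C g' = Y'"
    and "f' \<cdot> g = g' \<cdot> f"
  shows "g \<cdot> inverse_arrow C f = inverse_arrow C f' \<cdot> g'"
proof -
  note f = Iso_simps[OF assms(1)] and f' = Iso_simps[OF assms(2)]
  have "g \<cdot> inverse_arrow C f = inverse_arrow C f' \<cdot> ((f' \<cdot> g) \<cdot> inverse_arrow C f)"
    using f f' assms(1-8) by (simp del: Comp_assoc' add: Comp_assoc'[of "inverse_arrow C f" g f'])
  also have "\<dots> = inverse_arrow C f' \<cdot> g'"
    unfolding assms(9) using f f' assms(1-8) by simp
  finally show ?thesis .
qed

lemma splits_simps:
  assumes "splits C Y p B r s"
  shows "B \<in> Obj C" "r \<in> Arr C" "Dom C r = Y" "Cod C r = B" "s \<in> Arr C" "Dom C s = B" "Cod C s = Y"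
    and "s \<cdot> r = p" "r \<cdot> s = Ident C B" "p \<cdot> s = s" "r \<cdot> p = r"
    and "\<lbrakk>k \<in> Arr C; Cod C k = Y\<rbrakk> \<Longrightarrow> s \<cdot> (r \<cdot> k) = p \<cdot> k"
    and "\<lbrakk>k \<in> Arr C; Cod C k = B\<rbrakk> \<Longrightarrow> r \<cdot> (s \<cdot> k) = k"
    and "\<lbrakk>k \<in> Arr C; Cod C k = B\<rbrakk> \<Longrightarrow> p \<cdot> (s \<cdot> k) = s \<cdot> k"
    and "\<lbrakk>k \<in> Arr C; Cod C k = Y\<rbrakk> \<Longrightarrow> r \<cdot> (p \<cdot> k) = r \<cdot> k"
proof -
  show [simp]: "B \<in> Obj C" "r \<in> Arr C" "Dom C r = Y" "Cod C r = B" "s \<in> Arr C" "Dom C s = B" "Cod C s = Y"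
    and sr: "s \<cdot> r = p" and rs [simp]: "r \<cdot> s = Ident C B"
    using assms by (auto simp: splits_def Hom_def)
  have rs' [simp]: "r \<cdot> (s \<cdot> k) = k" if "k \<in> Arr C" "Cod C k = B" for k
    using Comp_assoc'[of k s r] that by simp
  then show "\<lbrakk>k \<in> Arr C; Cod C k = B\<rbrakk> \<Longrightarrow> r \<cdot> (s \<cdot> k) = k" .
  show "p \<cdot> s = s" "r \<cdot> p = r" unfolding sr[symmetric] by simp_all
  show "s \<cdot> (r \<cdot> k) = p \<cdot> k" if "k \<in> Arr C" "Cod C k = Y" for k
    unfolding sr[symmetric] using that by simp
  show "p \<cdot> (s \<cdot> k) = s \<cdot> k" if "k \<in> Arr C" "Cod C k = B" for k
    unfolding sr[symmetric] using that by simp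
  show "r \<cdot> (p \<cdot> k) = r \<cdot> k" if "k \<in> Arr C" "Cod C k = Y" for k
    unfolding sr[symmetric] using that by simp
qed

end

section \<open>Tensor calculus and unit coherence\<close>

context monoidal_category
begin

lemma Tobj_simps [simp]: "\<I> \<in> Obj C" "\<lbrakk>X \<in> Obj C; Y \<in> Obj C\<rbrakk> \<Longrightarrow> X \<boxtimes> Y \<in> Obj C"
  by (fact Unit_closed Tobj_closed)+

lemma Tarr_simps [simp]:
  assumes "f \<in> Arr C" "g \<in> Arr C"
  shows "f \<star> g \<in> Arr C" "Dom C (f \<star> g) = Dom C f \<boxtimes> Dom C g" "Cod C (f \<star> g) = Cod C f \<boxtimes> Cod C g"
  using Tarr_closed[of f "Dom C f" "Cod C f" g "Dom C g" "Cod C g"] assms by (simp_all add: Hom_def)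

lemma Tarr_Ident' [simp]: "\<lbrakk>X \<in> Obj C; Y \<in> Obj C\<rbrakk> \<Longrightarrow> Ident C X \<star> Ident C Y = Ident C (X \<boxtimes> Y)"
  by (fact Tarr_Ident)

lemma interchange [simp]:
  assumes "f \<in> Arr C" "g \<in> Arr C" "f' \<in> Arr C" "g' \<in> Arr C" "Cod C f = Dom C g" "Cod C f' = Dom C g'"
  shows "(g \<star> g') \<cdot> (f \<star> f') = (g \<cdot> f) \<star> (g' \<cdot> f')"
  using Tarr_Comp[of f "Dom C f" "Cod C f" g "Cod C g" f' "Dom C f'" "Cod C f'" g' "Cod C g'"] assms
  by (simp add: Hom_def)

lemma interchange_comp [simp]:
  assumes "f \<in> Arr C" "g \<in> Arr C" "f' \<in> Arr C" "g' \<in> Arr C" "Cod C f = Dom C g" "Cod C f' = Dom C g'"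
    and "h \<in> Arr C" "Cod C h = Dom C f \<boxtimes> Dom C f'"
  shows "(g \<star> g') \<cdot> ((f \<star> f') \<cdot> h) = ((g \<cdot> f) \<star> (g' \<cdot> f')) \<cdot> h"
  using assms Comp_assoc'[of h "f \<star> f'" "g \<star> g'"] by simp

abbreviation "al X Y Z \<equiv> Assoc C X Y Z"
abbreviation "al' X Y Z \<equiv> inverse_arrow C (Assoc C X Y Z)"
abbreviation "lu X \<equiv> Lunit C X"
abbreviation "lu' X \<equiv> inverse_arrow C (Lunit C X)"
abbreviation "ru X \<equiv> Runit C X"
abbreviation "ru' X \<equiv> inverse_arrow C (Runit C X)"

lemmas Assoc_simps [simp] = Iso_simps[OF Assoc_iso] Iso_cancel[OF Assoc_iso]
lemmas Lunit_simps [simp] = Iso_simps[OF Lunit_iso] Iso_cancel[OF Lunit_iso]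
lemmas Runit_simps [simp] = Iso_simps[OF Runit_iso] Iso_cancel[OF Runit_iso]

lemma Assoc_nat:
  assumes "f \<in> Arr C" "g \<in> Arr C" "h \<in> Arr C"
    and "Dom C f = X" "Dom C g = Y" "Dom C h = Z" "Cod C f = X'" "Cod C g = Y'" "Cod C h = Z'"
  shows "al X' Y' Z' \<cdot> ((f \<star> g) \<star> h) = (f \<star> (g \<star> h)) \<cdot> al X Y Z"
  using assms by (intro Assoc_natural) (simp_all add: Hom_def)

lemma Assoc_inv_nat:
  assumes "f \<in> Arr C" "g \<in> Arr C" "h \<in> Arr C"
    and "Dom C f = X" "Dom C g = Y" "Dom C h = Z" "Cod C f = X'" "Cod C g = Y'" "Cod C h = Z'"
  shows "((f \<star> g) \<star> h) \<cdot> al' X Y Z = al' X' Y' Z' \<cdot> (f \<star> (g \<star> h))"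
  using assms by (intro conj_inverse[OF Assoc_iso Assoc_iso _ _ _ _ _ _ Assoc_nat]) auto

lemma Lunit_nat:
  assumes "f \<in> Arr C" "Dom C f = X" "Cod C f = Y"
  shows "lu Y \<cdot> (Ident C \<I> \<star> f) = f \<cdot> lu X"
  using assms by (intro Lunit_natural) (simp_all add: Hom_def)

lemma Lunit_inv_nat:
  assumes "f \<in> Arr C" "Dom C f = X" "Cod C f = Y"
  shows "(Ident C \<I> \<star> f) \<cdot> lu' X = lu' Y \<cdot> f"
  using assms by (intro conj_inverse[OF Lunit_iso Lunit_iso _ _ _ _ _ _ Lunit_nat]) auto

lemma Runit_nat:
  assumes "f \<in> Arr C" "Dom C f = X" "Cod C f = Y"
  shows "ru Y \<cdot> (f \<star> Ident C \<I>) = f \<cdot> ru X"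
  using assms by (intro Runit_natural) (simp_all add: Hom_def)

lemma Runit_inv_nat:
  assumes "f \<in> Arr C" "Dom C f = X" "Cod C f = Y"
  shows "(f \<star> Ident C \<I>) \<cdot> ru' X = ru' Y \<cdot> f"
  using assms by (intro conj_inverse[OF Runit_iso Runit_iso _ _ _ _ _ _ Runit_nat]) auto

text \<open>Naturality writes \<open>f \<cdot> lu (Dom C f)\<close> in terms of
  \<open>Ident C \<I> \<star> f\<close>, and the unitor cancels.\<close>

lemma unit_tensor_faithful:
  assumes "f \<in> Arr C" "g \<in> Arr C" "Dom C f = Dom C g" "Cod C f = Cod C g"
    and "Ident C \<I> \<star> f = Ident C \<I> \<star> g"
  shows "f = g"
proof (rule Iso_right_cancel[OF Lunit_iso])
  show "f \<cdot> lu (Dom C f) = g \<cdot> lu (Dom C f)"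
    using Lunit_nat[of f] Lunit_nat[of g] assms by metis
qed (use assms in auto)

lemma tensor_unit_faithful:
  assumes "f \<in> Arr C" "g \<in> Arr C" "Dom C f = Dom C g" "Cod C f = Cod C g"
    and "f \<star> Ident C \<I> = g \<star> Ident C \<I>"
  shows "f = g"
proof (rule Iso_right_cancel[OF Runit_iso])
  show "f \<cdot> ru (Dom C f) = g \<cdot> ru (Dom C f)"
    using Runit_nat[of f] Runit_nat[of g] assms by metis
qed (use assms in auto)

lemma Tarr_Iso:
  assumes "f \<in> Iso C X Y" "g \<in> Iso C X' Y'"
  shows "f \<star> g \<in> Iso C (X \<boxtimes> X') (Y \<boxtimes> Y')"
proof -
  note f = Iso_simps[OF assms(1)] and g = Iso_simps[OF assms(2)]
  have [simp]: "X \<in> Obj C" "Y \<in> Obj C" "X' \<in> Obj C" "Y' \<in> Obj C"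
    using f(1-3) g(1-3) by auto
  have "inverse_arrows C (f \<star> g) (inverse_arrow C f \<star> inverse_arrow C g)"
    using f g by (simp add: inverse_arrows_def Hom_def)
  then show ?thesis using f g by (auto simp: Iso_def Hom_def)
qed

lemma Ident_Iso: "X \<in> Obj C \<Longrightarrow> Ident C X \<in> Iso C X X"
  by (auto simp: Iso_def inverse_arrows_def Hom_def intro!: exI[of _ "Ident C X"])

lemma Comp_Iso:
  assumes "f \<in> Iso C X Y" "g \<in> Iso C Y Z"
  shows "g \<cdot> f \<in> Iso C X Z"
proof -
  note f = Iso_simps[OF assms(1)] and g = Iso_simps[OF assms(2)]
  have "inverse_arrows C (g \<cdot> f) (inverse_arrow C f \<cdot> inverse_arrow C g)"
    using f g Iso_cancel[OF assms(1)] Iso_cancel[OF assms(2)] by (simp add: inverse_arrows_def Hom_def)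
  then show ?thesis using f g by (auto simp: Iso_def Hom_def)
qed

text \<open>
  Kelly's argument: after tensoring with \<open>\<I>\<close> on the left, which is faithful, the claim is one face of
  the pentagon for \<open>\<I>, \<I>, X, Y\<close> whose other faces are triangles and naturality squares.
\<close>

lemma Lunit_tensor:
  assumes [simp]: "X \<in> Obj C" "Y \<in> Obj C"
  shows "lu (X \<boxtimes> Y) \<cdot> al \<I> X Y = lu X \<star> Ident C Y"
proof (rule unit_tensor_faithful)
  let ?f = "al \<I> (\<I> \<boxtimes> X) Y \<cdot> (al \<I> \<I> X \<star> Ident C Y)"
  show "Ident C \<I> \<star> (lu (X \<boxtimes> Y) \<cdot> al \<I> X Y) = Ident C \<I> \<star> (lu X \<star> Ident C Y)"
  proof (rule Iso_right_cancel)
    show "?f \<in> Iso C (((\<I> \<boxtimes> \<I>) \<boxtimes> X) \<boxtimes> Y) (\<I> \<boxtimes> ((\<I> \<boxtimes> X) \<boxtimes> Y))"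
      by (rule Comp_Iso[OF Tarr_Iso[OF Assoc_iso Ident_Iso] Assoc_iso]) auto
    have "(Ident C \<I> \<star> (lu (X \<boxtimes> Y) \<cdot> al \<I> X Y)) \<cdot> ?f =
        (Ident C \<I> \<star> lu (X \<boxtimes> Y)) \<cdot> ((Ident C \<I> \<star> al \<I> X Y) \<cdot> ?f)"
      by simp
    also have "(Ident C \<I> \<star> al \<I> X Y) \<cdot> ?f = al \<I> \<I> (X \<boxtimes> Y) \<cdot> al (\<I> \<boxtimes> \<I>) X Y"
      by (simp add: pentagon)
    also have "(Ident C \<I> \<star> lu (X \<boxtimes> Y)) \<cdot> \<dots> =
        ((Ident C \<I> \<star> lu (X \<boxtimes> Y)) \<cdot> al \<I> \<I> (X \<boxtimes> Y)) \<cdot> al (\<I> \<boxtimes> \<I>) X Y"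
      by simp
    also have "\<dots> = (ru \<I> \<star> (Ident C X \<star> Ident C Y)) \<cdot> al (\<I> \<boxtimes> \<I>) X Y"
      by (simp add: triangle)
    also have "\<dots> = al \<I> X Y \<cdot> ((ru \<I> \<star> Ident C X) \<star> Ident C Y)"
      by (rule Assoc_nat[symmetric]) auto
    also have "ru \<I> \<star> Ident C X = (Ident C \<I> \<star> lu X) \<cdot> al \<I> \<I> X"
      by (simp add: triangle)
    also have "al \<I> X Y \<cdot> (\<dots> \<star> Ident C Y) =
        (al \<I> X Y \<cdot> ((Ident C \<I> \<star> lu X) \<star> Ident C Y)) \<cdot> (al \<I> \<I> X \<star> Ident C Y)"
      by simp
    also have "al \<I> X Y \<cdot> ((Ident C \<I> \<star> lu X) \<star> Ident C Y) =
        (Ident C \<I> \<star> (lu X \<star> Ident C Y)) \<cdot> al \<I> (\<I> \<boxtimes> X) Y"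
      by (rule Assoc_nat) auto
    finally show "(Ident C \<I> \<star> (lu (X \<boxtimes> Y) \<cdot> al \<I> X Y)) \<cdot> ?f =
        (Ident C \<I> \<star> (lu X \<star> Ident C Y)) \<cdot> ?f"
      by simp
  qed auto
qed auto

text \<open>The mirror image of the argument for the left unitor: tensoring with \<open>\<I>\<close>
  on the right is faithful, and the pentagon for \<open>X\<close>, \<open>Y\<close>,
  \<open>\<I>\<close>, \<open>\<I>\<close> reduces the claim to triangles and naturality
  squares.\<close>

lemma Runit_tensor:
  assumes [simp]: "X \<in> Obj C" "Y \<in> Obj C"
  shows "(Ident C X \<star> ru Y) \<cdot> al X Y \<I> = ru (X \<boxtimes> Y)"
proof (rule tensor_unit_faithful)
  show "((Ident C X \<star> ru Y) \<cdot> al X Y \<I>) \<star> Ident C \<I> = ru (X \<boxtimes> Y) \<star> Ident C \<I>"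
  proof (rule Iso_left_cancel[OF Assoc_iso])
    have "al X Y \<I> \<cdot> (ru (X \<boxtimes> Y) \<star> Ident C \<I>) =
        al X Y \<I> \<cdot> (((Ident C X \<star> Ident C Y) \<star> lu \<I>) \<cdot> al (X \<boxtimes> Y) \<I> \<I>)"
      by (simp add: triangle)
    also have "\<dots> = (al X Y \<I> \<cdot> ((Ident C X \<star> Ident C Y) \<star> lu \<I>)) \<cdot> al (X \<boxtimes> Y) \<I> \<I>"
      by simp
    also have "al X Y \<I> \<cdot> ((Ident C X \<star> Ident C Y) \<star> lu \<I>) =
        (Ident C X \<star> (Ident C Y \<star> lu \<I>)) \<cdot> al X Y (\<I> \<boxtimes> \<I>)"
      by (rule Assoc_nat) auto
    also have "\<dots> \<cdot> al (X \<boxtimes> Y) \<I> \<I> = (Ident C X \<star> (Ident C Y \<star> lu \<I>)) \<cdot>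
        ((Ident C X \<star> al Y \<I> \<I>) \<cdot> (al X (Y \<boxtimes> \<I>) \<I> \<cdot> (al X Y \<I> \<star> Ident C \<I>)))"
      by (simp add: pentagon del: interchange_comp)
    also have "\<dots> = (Ident C X \<star> ((Ident C Y \<star> lu \<I>) \<cdot> al Y \<I> \<I>)) \<cdot>
        (al X (Y \<boxtimes> \<I>) \<I> \<cdot> (al X Y \<I> \<star> Ident C \<I>))"
      by simp
    also have "\<dots> = ((Ident C X \<star> (ru Y \<star> Ident C \<I>)) \<cdot> al X (Y \<boxtimes> \<I>) \<I>) \<cdot> (al X Y \<I> \<star> Ident C \<I>)"
      by (simp add: triangle)
    also have "(Ident C X \<star> (ru Y \<star> Ident C \<I>)) \<cdot> al X (Y \<boxtimes> \<I>) \<I> =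
        al X Y \<I> \<cdot> ((Ident C X \<star> ru Y) \<star> Ident C \<I>)"
      by (rule Assoc_nat[symmetric]) auto
    finally show "al X Y \<I> \<cdot> (((Ident C X \<star> ru Y) \<cdot> al X Y \<I>) \<star> Ident C \<I>) =
        al X Y \<I> \<cdot> (ru (X \<boxtimes> Y) \<star> Ident C \<I>)"
      by simp
  qed auto
qed auto

lemma Lunit_inv_tensor:
  assumes [simp]: "X \<in> Obj C" "Y \<in> Obj C"
  shows "lu' (X \<boxtimes> Y) = al \<I> X Y \<cdot> (lu' X \<star> Ident C Y)"
proof -
  have "al \<I> X Y \<cdot> (lu' X \<star> Ident C Y) =
      lu' (X \<boxtimes> Y) \<cdot> ((lu (X \<boxtimes> Y) \<cdot> al \<I> X Y) \<cdot> (lu' X \<star> Ident C Y))"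
    by simp
  also have "\<dots> = lu' (X \<boxtimes> Y)" by (simp add: Lunit_tensor del: Comp_assoc')
  finally show ?thesis by simp
qed

lemma Runit_inv_tensor:
  assumes [simp]: "X \<in> Obj C" "Y \<in> Obj C"
  shows "al X Y \<I> \<cdot> ru' (X \<boxtimes> Y) = Ident C X \<star> ru' Y"
proof -
  have "al X Y \<I> \<cdot> ru' (X \<boxtimes> Y) =
      (Ident C X \<star> ru' Y) \<cdot> (((Ident C X \<star> ru Y) \<cdot> al X Y \<I>) \<cdot> ru' (X \<boxtimes> Y))"
    by simp
  also have "\<dots> = Ident C X \<star> ru' Y" by (simp add: Runit_tensor del: Comp_assoc')
  finally show ?thesis .
qed

section \<open>Zigzag identities and uniqueness of the coevaluation\<close>

lemma dual_pair_simps: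
  assumes "dual_pair C X X' ev co"
  shows "X \<in> Obj C" "X' \<in> Obj C" "ev \<in> Arr C" "Dom C ev = X' \<boxtimes> X" "Cod C ev = \<I>"
    and "co \<in> Arr C" "Dom C co = \<I>" "Cod C co = X \<boxtimes> X'"
  using assms by (auto simp: dual_pair_def Hom_def)

text \<open>The first zigzag identity with a spectator \<open>W\<close>: pentagon and naturality
  collect everything into arrows tensored with \<open>W\<close>, and the triangle turns the left
  unitor of \<open>W\<close> into the right unitor of the zigzag.\<close>

lemma zigzag_left:
  assumes d: "dual_pair C X X' ev co" and [simp]: "W \<in> Obj C"
  shows "(Ident C X \<star> (lu W \<cdot> (ev \<star> Ident C W) \<cdot> al' X' X W)) \<cdot> al X X' (X \<boxtimes> W) \<cdot>
    (co \<star> Ident C (X \<boxtimes> W)) \<cdot> lu' (X \<boxtimes> W) = Ident C (X \<boxtimes> W)" (is "?E \<cdot> _ = _")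
proof -
  note [simp] = dual_pair_simps[OF d]
  let ?x = "Ident C X" and ?w = "Ident C W"
  have zz: "ru X \<cdot> (?x \<star> ev) \<cdot> al X X' X \<cdot> (co \<star> ?x) = lu X"
    using d by (simp add: dual_pair_def)
  have "?E \<cdot> al X X' (X \<boxtimes> W) \<cdot> (co \<star> Ident C (X \<boxtimes> W)) \<cdot> lu' (X \<boxtimes> W) =
      ?E \<cdot> al X X' (X \<boxtimes> W) \<cdot> ((co \<star> (?x \<star> ?w)) \<cdot> al \<I> X W) \<cdot> (lu' X \<star> ?w)"
    by (simp add: Lunit_inv_tensor)
  also have "(co \<star> (?x \<star> ?w)) \<cdot> al \<I> X W = al (X \<boxtimes> X') X W \<cdot> ((co \<star> ?x) \<star> ?w)"
    by (rule Assoc_nat[symmetric]) auto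
  also have "?E \<cdot> al X X' (X \<boxtimes> W) \<cdot> (al (X \<boxtimes> X') X W \<cdot> ((co \<star> ?x) \<star> ?w)) \<cdot> (lu' X \<star> ?w) =
      ?E \<cdot> (al X X' (X \<boxtimes> W) \<cdot> al (X \<boxtimes> X') X W) \<cdot> (((co \<star> ?x) \<cdot> lu' X) \<star> ?w)"
    by simp
  also have "al X X' (X \<boxtimes> W) \<cdot> al (X \<boxtimes> X') X W =
      (?x \<star> al X' X W) \<cdot> al X (X' \<boxtimes> X) W \<cdot> (al X X' X \<star> ?w)"
    by (rule pentagon) auto
  also have "?E \<cdot> ((?x \<star> al X' X W) \<cdot> al X (X' \<boxtimes> X) W \<cdot> (al X X' X \<star> ?w)) \<cdot>
        (((co \<star> ?x) \<cdot> lu' X) \<star> ?w) =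
      (?x \<star> lu W) \<cdot> ((?x \<star> (ev \<star> ?w)) \<cdot> al X (X' \<boxtimes> X) W) \<cdot> ((al X X' X \<cdot> (co \<star> ?x) \<cdot> lu' X) \<star> ?w)"
    by simp
  also have "(?x \<star> (ev \<star> ?w)) \<cdot> al X (X' \<boxtimes> X) W = al X \<I> W \<cdot> ((?x \<star> ev) \<star> ?w)"
    by (rule Assoc_nat[symmetric]) auto
  also have "(?x \<star> lu W) \<cdot> (al X \<I> W \<cdot> ((?x \<star> ev) \<star> ?w)) \<cdot> ((al X X' X \<cdot> (co \<star> ?x) \<cdot> lu' X) \<star> ?w) =
      ((?x \<star> lu W) \<cdot> al X \<I> W) \<cdot> (((?x \<star> ev) \<cdot> al X X' X \<cdot> (co \<star> ?x) \<cdot> lu' X) \<star> ?w)"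
    by simp
  also have "(?x \<star> lu W) \<cdot> al X \<I> W = ru X \<star> ?w" by (rule triangle) auto
  also have "(ru X \<star> ?w) \<cdot> (((?x \<star> ev) \<cdot> al X X' X \<cdot> (co \<star> ?x) \<cdot> lu' X) \<star> ?w) =
      ((ru X \<cdot> (?x \<star> ev) \<cdot> al X X' X \<cdot> (co \<star> ?x)) \<cdot> lu' X) \<star> ?w"
    by simp
  also have "\<dots> = Ident C (X \<boxtimes> W)" unfolding zz by simp
  finally show ?thesis .
qed

text \<open>The second zigzag identity with a spectator \<open>W\<close>; the unitors at the two
  ends are handled by \<open>Lunit_tensor\<close> and the triangle.\<close>

lemma zigzag_right:
  assumes d: "dual_pair C X X' ev co" and [simp]: "W \<in> Obj C"
  shows "lu (X' \<boxtimes> W) \<cdot> (ev \<star> Ident C (X' \<boxtimes> W)) \<cdot> al' X' X (X' \<boxtimes> W) \<cdot>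
    (Ident C X' \<star> (al X X' W \<cdot> (co \<star> Ident C W) \<cdot> lu' W)) = Ident C (X' \<boxtimes> W)"
proof -
  note [simp] = dual_pair_simps[OF d]
  let ?x = "Ident C X'" and ?w = "Ident C W"
  let ?L = "lu (X' \<boxtimes> W)" and ?ev = "ev \<star> Ident C (X' \<boxtimes> W)"
  have zz: "lu X' \<cdot> (ev \<star> ?x) \<cdot> al' X' X X' \<cdot> (?x \<star> co) = ru X'"
    using d by (simp add: dual_pair_def)
  \<comment> \<open>The pentagon, rearranged to exchange the inner associator for one that
    naturality carries past \<open>ev\<close>.\<close>
  have pent: "al' X' X (X' \<boxtimes> W) \<cdot> (?x \<star> al X X' W) =
      al (X' \<boxtimes> X) X' W \<cdot> (al' X' X X' \<star> ?w) \<cdot> al' X' (X \<boxtimes> X') W"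
  proof -
    let ?k = "(al' X' X X' \<star> ?w) \<cdot> al' X' (X \<boxtimes> X') W"
    have "al (X' \<boxtimes> X) X' W \<cdot> ?k =
        al' X' X (X' \<boxtimes> W) \<cdot> ((al X' X (X' \<boxtimes> W) \<cdot> al (X' \<boxtimes> X) X' W) \<cdot> ?k)"
      by simp
    also have "al X' X (X' \<boxtimes> W) \<cdot> al (X' \<boxtimes> X) X' W =
        (?x \<star> al X X' W) \<cdot> al X' (X \<boxtimes> X') W \<cdot> (al X' X X' \<star> ?w)"
      by (rule pentagon) auto
    finally show ?thesis by simp
  qed
  have tri: "(ru X' \<star> ?w) \<cdot> al' X' \<I> W = ?x \<star> lu W"
    by (subst triangle[symmetric]) auto
  have "?L \<cdot> ?ev \<cdot> al' X' X (X' \<boxtimes> W) \<cdot> (?x \<star> (al X X' W \<cdot> (co \<star> ?w) \<cdot> lu' W)) =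
      ?L \<cdot> ?ev \<cdot> (al' X' X (X' \<boxtimes> W) \<cdot> (?x \<star> al X X' W)) \<cdot> (?x \<star> ((co \<star> ?w) \<cdot> lu' W))"
    by simp
  also note pent
  also have "?L \<cdot> ?ev \<cdot> (al (X' \<boxtimes> X) X' W \<cdot> (al' X' X X' \<star> ?w) \<cdot> al' X' (X \<boxtimes> X') W) \<cdot>
        (?x \<star> ((co \<star> ?w) \<cdot> lu' W)) =
      ?L \<cdot> ((ev \<star> (?x \<star> ?w)) \<cdot> al (X' \<boxtimes> X) X' W) \<cdot> (al' X' X X' \<star> ?w) \<cdot>
        (al' X' (X \<boxtimes> X') W \<cdot> (?x \<star> (co \<star> ?w))) \<cdot> (?x \<star> lu' W)"
    by simp
  also have "(ev \<star> (?x \<star> ?w)) \<cdot> al (X' \<boxtimes> X) X' W = al \<I> X' W \<cdot> ((ev \<star> ?x) \<star> ?w)"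
    by (rule Assoc_nat[symmetric]) auto
  also have "al' X' (X \<boxtimes> X') W \<cdot> (?x \<star> (co \<star> ?w)) = ((?x \<star> co) \<star> ?w) \<cdot> al' X' \<I> W"
    by (rule Assoc_inv_nat[symmetric]) auto
  also have "?L \<cdot> (al \<I> X' W \<cdot> ((ev \<star> ?x) \<star> ?w)) \<cdot> (al' X' X X' \<star> ?w) \<cdot>
        (((?x \<star> co) \<star> ?w) \<cdot> al' X' \<I> W) \<cdot> (?x \<star> lu' W) =
      (?L \<cdot> al \<I> X' W) \<cdot> (((ev \<star> ?x) \<cdot> al' X' X X' \<cdot> (?x \<star> co)) \<star> ?w) \<cdot> al' X' \<I> W \<cdot> (?x \<star> lu' W)"
    by simp
  also have "?L \<cdot> al \<I> X' W = lu X' \<star> ?w" by (rule Lunit_tensor) auto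
  also have "(lu X' \<star> ?w) \<cdot> (((ev \<star> ?x) \<cdot> al' X' X X' \<cdot> (?x \<star> co)) \<star> ?w) \<cdot> al' X' \<I> W \<cdot> (?x \<star> lu' W) =
      (((lu X' \<cdot> (ev \<star> ?x) \<cdot> al' X' X X' \<cdot> (?x \<star> co)) \<star> ?w) \<cdot> al' X' \<I> W) \<cdot> (?x \<star> lu' W)"
    by simp
  also note zz
  also note tri
  also have "(?x \<star> lu W) \<cdot> (?x \<star> lu' W) = Ident C (X' \<boxtimes> W)" by simp
  finally show ?thesis .
qed

text \<open>Composing \<open>co'\<close> with the zigzag of \<open>co\<close> changes nothing;
  sliding \<open>co'\<close> past \<open>co\<close> lets the second zigzag of \<open>co'\<close>
  absorb the evaluation, and only \<open>co\<close> is left.\<close>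

lemma dual_pair_coev_formula:
  assumes d: "dual_pair C X X' ev co" and d': "dual_pair C X X' ev co'"
  shows "co' = (Ident C X \<star> ru X') \<cdot> al X X' \<I> \<cdot> (co \<star> Ident C \<I>) \<cdot> lu' \<I>"
proof -
  note [simp] = dual_pair_simps[OF d] dual_pair_simps[OF d']
  let ?x = "Ident C X" and ?y = "Ident C X'"
  let ?E = "?x \<star> (lu X' \<cdot> (ev \<star> ?y) \<cdot> al' X' X X')"
  have zz: "lu X' \<cdot> (ev \<star> ?y) \<cdot> al' X' X X' \<cdot> (?y \<star> co') = ru X'"
    using d' by (simp add: dual_pair_def)
  have "co' = (?E \<cdot> al X X' (X \<boxtimes> X') \<cdot> (co \<star> Ident C (X \<boxtimes> X')) \<cdot> lu' (X \<boxtimes> X')) \<cdot> co'"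
    using zigzag_left[OF d, of X'] by simp
  also have "\<dots> = ?E \<cdot> al X X' (X \<boxtimes> X') \<cdot> (co \<star> Ident C (X \<boxtimes> X')) \<cdot> (lu' (X \<boxtimes> X') \<cdot> co')"
    by simp
  also have "lu' (X \<boxtimes> X') \<cdot> co' = (Ident C \<I> \<star> co') \<cdot> lu' \<I>"
    by (rule Lunit_inv_nat[symmetric]) auto
  also have "?E \<cdot> al X X' (X \<boxtimes> X') \<cdot> (co \<star> Ident C (X \<boxtimes> X')) \<cdot> ((Ident C \<I> \<star> co') \<cdot> lu' \<I>) =
     ?E \<cdot> (al X X' (X \<boxtimes> X') \<cdot> ((?x \<star> ?y) \<star> co')) \<cdot> (co \<star> Ident C \<I>) \<cdot> lu' \<I>"
    by simp
  also have "al X X' (X \<boxtimes> X') \<cdot> ((?x \<star> ?y) \<star> co') = (?x \<star> (?y \<star> co')) \<cdot> al X X' \<I>"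
    by (rule Assoc_nat) auto
  also have "?E \<cdot> ((?x \<star> (?y \<star> co')) \<cdot> al X X' \<I>) \<cdot> (co \<star> Ident C \<I>) \<cdot> lu' \<I> =
      (?x \<star> (lu X' \<cdot> (ev \<star> ?y) \<cdot> al' X' X X' \<cdot> (?y \<star> co'))) \<cdot> al X X' \<I> \<cdot> (co \<star> Ident C \<I>) \<cdot> lu' \<I>"
    by simp
  also note zz
  finally show ?thesis .
qed

text \<open>The right-hand side of the formula does not mention \<open>co'\<close>, so it computes
  \<open>co\<close> as well.\<close>

lemma dual_pair_coev_unique:
  "\<lbrakk>dual_pair C X X' ev co; dual_pair C X X' ev co'\<rbrakk> \<Longrightarrow> co' = co"
  using dual_pair_coev_formula by metis

text \<open>Naturality of the unitor at itself gives
  \<open>lu (\<I> \<boxtimes> \<I>) = Ident C \<I> \<star> lu \<I>\<close>; then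
  \<open>Lunit_tensor\<close> and the triangle give the same value to both unitors tensored with
  \<open>\<I>\<close>.\<close>

lemma Lunit_Unit: "lu \<I> = ru \<I>"
proof (rule tensor_unit_faithful)
  have "Ident C \<I> \<star> lu \<I> = lu (\<I> \<boxtimes> \<I>)"
    by (rule Iso_left_cancel[OF Lunit_iso]) (auto simp: Lunit_nat)
  then show "lu \<I> \<star> Ident C \<I> = ru \<I> \<star> Ident C \<I>"
    using Lunit_tensor[of \<I> \<I>] triangle[of \<I> \<I>] by simp
qed auto

text \<open>The shape of the pentagon that arises when associativity of a multiplication is tensored
  with a spectator.\<close>

lemma pentagon_inv:
  assumes [simp]: "W \<in> Obj C" "X \<in> Obj C" "Y \<in> Obj C" "Z \<in> Obj C"
  shows "(al W X Y \<star> Ident C Z) \<cdot> al' (W \<boxtimes> X) Y Z \<cdot> al' W X (Y \<boxtimes> Z) =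
    al' W (X \<boxtimes> Y) Z \<cdot> (Ident C W \<star> al' X Y Z)"
proof -
  let ?k = "al' (W \<boxtimes> X) Y Z \<cdot> al' W X (Y \<boxtimes> Z)"
  let ?l = "al' W (X \<boxtimes> Y) Z \<cdot> (Ident C W \<star> al' X Y Z)"
  have "?l = ?l \<cdot> ((al W X (Y \<boxtimes> Z) \<cdot> al (W \<boxtimes> X) Y Z) \<cdot> ?k)"
    by simp
  also have "al W X (Y \<boxtimes> Z) \<cdot> al (W \<boxtimes> X) Y Z =
      (Ident C W \<star> al X Y Z) \<cdot> al W (X \<boxtimes> Y) Z \<cdot> (al W X Y \<star> Ident C Z)"
    by (rule pentagon) auto
  finally show ?thesis by simp
qed

end

section \<open>The algebra of module endomorphisms\<close>

locale frobenius_algebra = k_linear_symmetric_monoidal_category C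
  for C :: "('o, 'm, 'k::field) ksmc" (structure) +
  fixes A :: "('o, 'm) frobenius_data"
  assumes frobenius: "commutative_frobenius_algebra C A"
begin

abbreviation "X \<equiv> Fobj A"
abbreviation "m \<equiv> Fmult A"
abbreviation "u \<equiv> Funit A"
abbreviation "ep \<equiv> Fcounit A"
abbreviation "ev \<equiv> Fpairing C A"
abbreviation "co \<equiv> Fcopairing C A"
abbreviation "i \<equiv> Ident C X"
abbreviation "x \<equiv> handle_endo C A"

lemma structure_simps [simp]:
  "X \<in> Obj C"
  "m \<in> Arr C" "Dom C m = X \<boxtimes> X" "Cod C m = X"
  "u \<in> Arr C" "Dom C u = \<I>" "Cod C u = X"
  "ep \<in> Arr C" "Dom C ep = X" "Cod C ep = \<I>"
  using frobenius
  by (auto simp: commutative_frobenius_algebra_def commutative_algebra_object_def Let_def Hom_def)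

lemma mult_assoc: "m \<cdot> (m \<star> i) = m \<cdot> (i \<star> m) \<cdot> al X X X"
  and unit_left: "m \<cdot> (u \<star> i) = lu X"
  and unit_right: "m \<cdot> (i \<star> u) = ru X"
  and mult_braid: "m \<cdot> Braid C X X = m"
  using frobenius
  by (auto simp: commutative_frobenius_algebra_def commutative_algebra_object_def Let_def)

lemma Braid_simps [simp]:
  "Braid C X X \<in> Arr C" "Dom C (Braid C X X) = X \<boxtimes> X" "Cod C (Braid C X X) = X \<boxtimes> X"
  using Braid_closed[of X X] by (simp_all add: Hom_def)

section \<open>The copairing, the Frobenius relation and the handle endomorphism\<close>

lemma dual_pair_copairing: "dual_pair C X X ev co"
proof -
  obtain c where "dual_pair C X X ev c"
    using frobenius by (auto simp: commutative_frobenius_algebra_def)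
  then show ?thesis
    unfolding Fcopairing_def by (rule theI) (rule dual_pair_coev_unique[OF \<open>dual_pair C X X ev c\<close>])
qed

lemmas pairing_simps [simp] = dual_pair_simps(3-)[OF dual_pair_copairing]

text \<open>\<open>(m \<star> Ident C W) \<cdot> al' X X W\<close> is the action of the algebra on
  the free module \<open>X \<boxtimes> W\<close>; this is associativity of that action.\<close>

lemma mult_ext_assoc:
  assumes [simp]: "W \<in> Obj C"
  shows "(m \<star> Ident C W) \<cdot> al' X X W \<cdot> (i \<star> ((m \<star> Ident C W) \<cdot> al' X X W)) =
    (m \<star> Ident C W) \<cdot> al' X X W \<cdot> (m \<star> Ident C (X \<boxtimes> W)) \<cdot> al' X X (X \<boxtimes> W)"
proof -
  let ?w = "Ident C W"
  have "(m \<star> ?w) \<cdot> al' X X W \<cdot> (m \<star> Ident C (X \<boxtimes> W)) \<cdot> al' X X (X \<boxtimes> W) =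
      (m \<star> ?w) \<cdot> (al' X X W \<cdot> (m \<star> (i \<star> ?w))) \<cdot> al' X X (X \<boxtimes> W)"
    by simp
  also have "al' X X W \<cdot> (m \<star> (i \<star> ?w)) = ((m \<star> i) \<star> ?w) \<cdot> al' (X \<boxtimes> X) X W"
    by (rule Assoc_inv_nat[symmetric]) auto
  also have "(m \<star> ?w) \<cdot> (((m \<star> i) \<star> ?w) \<cdot> al' (X \<boxtimes> X) X W) \<cdot> al' X X (X \<boxtimes> W) =
      ((m \<cdot> (m \<star> i)) \<star> ?w) \<cdot> al' (X \<boxtimes> X) X W \<cdot> al' X X (X \<boxtimes> W)"
    by simp
  also note mult_assoc
  also have "((m \<cdot> (i \<star> m) \<cdot> al X X X) \<star> ?w) \<cdot> al' (X \<boxtimes> X) X W \<cdot> al' X X (X \<boxtimes> W) =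
      ((m \<cdot> (i \<star> m)) \<star> ?w) \<cdot> (al X X X \<star> ?w) \<cdot> al' (X \<boxtimes> X) X W \<cdot> al' X X (X \<boxtimes> W)"
    by simp
  also have "(al X X X \<star> ?w) \<cdot> al' (X \<boxtimes> X) X W \<cdot> al' X X (X \<boxtimes> W) =
      al' X (X \<boxtimes> X) W \<cdot> (i \<star> al' X X W)"
    by (rule pentagon_inv) auto
  also have "((m \<cdot> (i \<star> m)) \<star> ?w) \<cdot> al' X (X \<boxtimes> X) W \<cdot> (i \<star> al' X X W) =
      (m \<star> ?w) \<cdot> (((i \<star> m) \<star> ?w) \<cdot> al' X (X \<boxtimes> X) W) \<cdot> (i \<star> al' X X W)"
    by simp
  also have "((i \<star> m) \<star> ?w) \<cdot> al' X (X \<boxtimes> X) W = al' X X W \<cdot> (i \<star> (m \<star> ?w))"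
    by (rule Assoc_inv_nat) auto
  finally show ?thesis by simp
qed

text \<open>As \<open>f\<close> touches only the spectator, \<open>i \<star> f\<close> is a map of
  free modules.\<close>

lemma mult_ext_nat:
  assumes [simp]: "f \<in> Arr C" "Dom C f = W" "Cod C f = W'"
  shows "((m \<star> Ident C W') \<cdot> al' X X W') \<cdot> (i \<star> (i \<star> f)) = (i \<star> f) \<cdot> (m \<star> Ident C W) \<cdot> al' X X W"
proof -
  have [simp]: "W \<in> Obj C" "W' \<in> Obj C"
    using arr_Dom[OF assms(1)] arr_Cod[OF assms(1)] by simp_all
  have "((m \<star> Ident C W') \<cdot> al' X X W') \<cdot> (i \<star> (i \<star> f)) =
      (m \<star> Ident C W') \<cdot> (al' X X W' \<cdot> (i \<star> (i \<star> f)))"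
    by simp
  also have "al' X X W' \<cdot> (i \<star> (i \<star> f)) = ((i \<star> i) \<star> f) \<cdot> al' X X W"
    by (rule Assoc_inv_nat[symmetric]) auto
  finally show ?thesis by simp
qed

text \<open>The Frobenius relation. With \<open>ev\<close> read as \<open>ep \<cdot> m\<close>,
  associativity and naturality of the free module action bring the inner copairing \<open>?c\<close>
  next to \<open>?E\<close>, where a zigzag cancels it; the outer copairing remains.\<close>

lemma Fcomult_eq: "Fcomult C A = (m \<star> i) \<cdot> al' X X X \<cdot> (i \<star> co) \<cdot> ru' X"
proof -
  let ?w = "Ident C (X \<boxtimes> X)" and ?wx = "Ident C (X \<boxtimes> X \<boxtimes> X)"
  let ?c = "al X X X \<cdot> (co \<star> i) \<cdot> lu' X"
  let ?M = "(m \<star> ?w) \<cdot> al' X X (X \<boxtimes> X)"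
  let ?M' = "(m \<star> ?wx) \<cdot> al' X X (X \<boxtimes> X \<boxtimes> X)"
  let ?E = "lu (X \<boxtimes> X) \<cdot> (ev \<star> ?w) \<cdot> al' X X (X \<boxtimes> X)"
  have E: "?E = lu (X \<boxtimes> X) \<cdot> (ep \<star> ?w) \<cdot> ?M"
    by (simp add: Fpairing_def)
  have "Fcomult C A = ?E \<cdot> (i \<star> (?M \<cdot> (i \<star> ?c) \<cdot> co)) \<cdot> ru' X"
    by (simp add: Fcomult_def dual_arrow_def tensor_coev_def Let_def)
  also have "\<dots> = (?E \<cdot> (i \<star> ?M)) \<cdot> (i \<star> (i \<star> ?c)) \<cdot> (i \<star> co) \<cdot> ru' X"
    by simp
  also have "?E \<cdot> (i \<star> ?M) = (lu (X \<boxtimes> X) \<cdot> (ep \<star> ?w)) \<cdot> (m \<star> ?w) \<cdot> al' X X (X \<boxtimes> X) \<cdot> (i \<star> ?M)"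
    unfolding E by simp
  also have "(m \<star> ?w) \<cdot> al' X X (X \<boxtimes> X) \<cdot> (i \<star> ?M) = (m \<star> ?w) \<cdot> al' X X (X \<boxtimes> X) \<cdot> ?M'"
    by (rule mult_ext_assoc) auto
  also have "((lu (X \<boxtimes> X) \<cdot> (ep \<star> ?w)) \<cdot> (m \<star> ?w) \<cdot> al' X X (X \<boxtimes> X) \<cdot> ?M') \<cdot>
        (i \<star> (i \<star> ?c)) \<cdot> (i \<star> co) \<cdot> ru' X =
      ?E \<cdot> (?M' \<cdot> (i \<star> (i \<star> ?c))) \<cdot> (i \<star> co) \<cdot> ru' X"
    unfolding E by simp
  also have "?M' \<cdot> (i \<star> (i \<star> ?c)) = (i \<star> ?c) \<cdot> (m \<star> i) \<cdot> al' X X X"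
    by (rule mult_ext_nat) auto
  also have "?E \<cdot> ((i \<star> ?c) \<cdot> (m \<star> i) \<cdot> al' X X X) \<cdot> (i \<star> co) \<cdot> ru' X =
      (lu (X \<boxtimes> X) \<cdot> (ev \<star> ?w) \<cdot> al' X X (X \<boxtimes> X) \<cdot> (i \<star> ?c)) \<cdot> (m \<star> i) \<cdot> al' X X X \<cdot> (i \<star> co) \<cdot> ru' X"
    by simp
  also have "lu (X \<boxtimes> X) \<cdot> (ev \<star> ?w) \<cdot> al' X X (X \<boxtimes> X) \<cdot> (i \<star> ?c) = ?w"
    using zigzag_right[OF dual_pair_copairing, of X] by simp
  finally show ?thesis by simp
qed

text \<open>By the Frobenius relation and associativity, \<open>x\<close> is multiplication on the
  right by the point \<open>m \<cdot> co\<close>.\<close>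

lemma handle_endo_eq: "x = m \<cdot> (i \<star> (m \<cdot> co)) \<cdot> ru' X"
proof -
  have "x = (m \<cdot> (m \<star> i)) \<cdot> al' X X X \<cdot> (i \<star> co) \<cdot> ru' X"
    unfolding handle_endo_def Fcomult_eq by simp
  also have "\<dots> = m \<cdot> (i \<star> (m \<cdot> co)) \<cdot> ru' X"
    unfolding mult_assoc by simp
  finally show ?thesis .
qed

section \<open>Endomorphisms of the algebra as a module over itself\<close>

definition module_endo :: "'m \<Rightarrow> bool" where
  "module_endo t \<longleftrightarrow> t \<in> Hom C X X \<and> t \<cdot> m = m \<cdot> (t \<star> i)"

lemma module_endo_simps:
  assumes "module_endo t"
  shows "t \<in> Arr C" "Dom C t = X" "Cod C t = X" "t \<cdot> m = m \<cdot> (t \<star> i)"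
  using assms by (auto simp: module_endo_def Hom_def)

text \<open>Since \<open>m\<close> absorbs the braiding, the two factors can be exchanged.\<close>

lemma module_endo_right:
  assumes "t \<in> Hom C X X"
  shows "module_endo t \<longleftrightarrow> t \<cdot> m = m \<cdot> (i \<star> t)"
proof -
  have [simp]: "t \<in> Arr C" "Dom C t = X" "Cod C t = X" using assms by (auto simp: Hom_def)
  have nat: "(i \<star> t) \<cdot> Braid C X X = Braid C X X \<cdot> (t \<star> i)"
    using Braid_natural[of t X X i X X] by (simp add: Hom_def)
  have nat': "(t \<star> i) \<cdot> Braid C X X = Braid C X X \<cdot> (i \<star> t)"
    using Braid_natural[of i X X t X X] by (simp add: Hom_def)
  have "t \<cdot> m = (t \<cdot> m) \<cdot> Braid C X X" using mult_braid by simp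
  also have "\<dots> = m \<cdot> (t \<star> i)" if "t \<cdot> m = m \<cdot> (i \<star> t)"
  proof -
    have "(t \<cdot> m) \<cdot> Braid C X X = m \<cdot> ((i \<star> t) \<cdot> Braid C X X)" unfolding that by simp
    also have "\<dots> = (m \<cdot> Braid C X X) \<cdot> (t \<star> i)" unfolding nat by simp
    finally show ?thesis unfolding mult_braid .
  qed
  finally have 1: "t \<cdot> m = m \<cdot> (t \<star> i)" if "t \<cdot> m = m \<cdot> (i \<star> t)" using that by blast
  have "t \<cdot> m = (t \<cdot> m) \<cdot> Braid C X X" using mult_braid by simp
  also have "\<dots> = m \<cdot> (i \<star> t)" if "t \<cdot> m = m \<cdot> (t \<star> i)"
  proof -
    have "(t \<cdot> m) \<cdot> Braid C X X = m \<cdot> ((t \<star> i) \<cdot> Braid C X X)" unfolding that by simp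
    also have "\<dots> = (m \<cdot> Braid C X X) \<cdot> (i \<star> t)" unfolding nat' by simp
    finally show ?thesis unfolding mult_braid .
  qed
  finally have 2: "t \<cdot> m = m \<cdot> (i \<star> t)" if "t \<cdot> m = m \<cdot> (t \<star> i)" using that by blast
  from 1 2 assms show ?thesis by (auto simp: module_endo_def)
qed

text \<open>\<open>x\<close> multiplies on the right by a point \<open>h\<close>, so
  \<open>(a b) h = a (b h)\<close> lets it act on the second factor alone; commutativity transfers
  this to the first.\<close>

lemma module_endo_handle_endo: "module_endo x"
proof -
  let ?h = "m \<cdot> co"
  have "x \<cdot> m = m \<cdot> (i \<star> ?h) \<cdot> (ru' X \<cdot> m)" unfolding handle_endo_eq by simp
  also have "ru' X \<cdot> m = (m \<star> Ident C \<I>) \<cdot> ru' (X \<boxtimes> X)"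
    by (rule Runit_inv_nat[symmetric]) auto
  also have "m \<cdot> (i \<star> ?h) \<cdot> ((m \<star> Ident C \<I>) \<cdot> ru' (X \<boxtimes> X)) =
      (m \<cdot> (m \<star> i)) \<cdot> ((i \<star> i) \<star> ?h) \<cdot> ru' (X \<boxtimes> X)"
    by simp
  also note mult_assoc
  also have "(m \<cdot> (i \<star> m) \<cdot> al X X X) \<cdot> ((i \<star> i) \<star> ?h) \<cdot> ru' (X \<boxtimes> X) =
      m \<cdot> (i \<star> m) \<cdot> (al X X X \<cdot> ((i \<star> i) \<star> ?h)) \<cdot> ru' (X \<boxtimes> X)"
    by simp
  also have "al X X X \<cdot> ((i \<star> i) \<star> ?h) = (i \<star> (i \<star> ?h)) \<cdot> al X X \<I>"
    by (rule Assoc_nat) auto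
  also have "m \<cdot> (i \<star> m) \<cdot> ((i \<star> (i \<star> ?h)) \<cdot> al X X \<I>) \<cdot> ru' (X \<boxtimes> X) =
      m \<cdot> (i \<star> (m \<cdot> (i \<star> ?h))) \<cdot> (al X X \<I> \<cdot> ru' (X \<boxtimes> X))"
    by simp
  also have "al X X \<I> \<cdot> ru' (X \<boxtimes> X) = i \<star> ru' X"
    by (rule Runit_inv_tensor) auto
  also have "m \<cdot> (i \<star> (m \<cdot> (i \<star> ?h))) \<cdot> (i \<star> ru' X) = m \<cdot> (i \<star> x)"
    unfolding handle_endo_eq by simp
  finally have "x \<cdot> m = m \<cdot> (i \<star> x)" .
  moreover have "x \<in> Hom C X X" unfolding handle_endo_eq by (simp add: Hom_def)
  ultimately show ?thesis by (simp add: module_endo_right)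
qed

lemmas handle_endo_simps [simp] = module_endo_simps(1-3)[OF module_endo_handle_endo]

lemma mult_by_simps [simp]:
  assumes "f \<in> Arr C" "Dom C f = \<I>" "Cod C f = X"
  shows "mult_by C A f \<in> Arr C" "Dom C (mult_by C A f) = X" "Cod C (mult_by C A f) = X"
  using assms by (simp_all add: mult_by_def)

text \<open>In elements this is \<open>f (a b) = (f a) b\<close>; coherence of the left unitor with
  tensor products accounts for the bracketing.\<close>

lemma module_endo_mult_by:
  assumes "f \<in> Hom C \<I> X"
  shows "module_endo (mult_by C A f)"
proof -
  have [simp]: "f \<in> Arr C" "Dom C f = \<I>" "Cod C f = X" using assms by (auto simp: Hom_def)
  have "mult_by C A f \<cdot> m = m \<cdot> (f \<star> i) \<cdot> (lu' X \<cdot> m)" by (simp add: mult_by_def)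
  also have "lu' X \<cdot> m = (Ident C \<I> \<star> m) \<cdot> lu' (X \<boxtimes> X)"
    by (rule Lunit_inv_nat[symmetric]) auto
  also have "lu' (X \<boxtimes> X) = al \<I> X X \<cdot> (lu' X \<star> i)"
    by (rule Lunit_inv_tensor) auto
  also have "m \<cdot> (f \<star> i) \<cdot> ((Ident C \<I> \<star> m) \<cdot> (al \<I> X X \<cdot> (lu' X \<star> i))) =
      m \<cdot> (i \<star> m) \<cdot> ((f \<star> (i \<star> i)) \<cdot> al \<I> X X) \<cdot> (lu' X \<star> i)"
    by simp
  also have "(f \<star> (i \<star> i)) \<cdot> al \<I> X X = al X X X \<cdot> ((f \<star> i) \<star> i)"
    by (rule Assoc_nat[symmetric]) auto
  also have "m \<cdot> (i \<star> m) \<cdot> (al X X X \<cdot> ((f \<star> i) \<star> i)) \<cdot> (lu' X \<star> i) =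
      (m \<cdot> (i \<star> m) \<cdot> al X X X) \<cdot> (((f \<star> i) \<cdot> lu' X) \<star> i)"
    by simp
  also note mult_assoc[symmetric]
  finally show ?thesis by (simp add: module_endo_def Hom_def mult_by_def)
qed

text \<open>In elements, \<open>f 1 = f\<close>. \<open>mult_by\<close> contains a left unitor while
  the unit law produces a right one; they agree on \<open>\<I>\<close>.\<close>

lemma mult_by_unit:
  assumes "f \<in> Hom C \<I> X"
  shows "mult_by C A f \<cdot> u = f"
proof -
  have [simp]: "f \<in> Arr C" "Dom C f = \<I>" "Cod C f = X" using assms by (auto simp: Hom_def)
  have "mult_by C A f \<cdot> u = m \<cdot> (f \<star> i) \<cdot> (lu' X \<cdot> u)" by (simp add: mult_by_def)
  also have "lu' X \<cdot> u = (Ident C \<I> \<star> u) \<cdot> lu' \<I>"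
    by (rule Lunit_inv_nat[symmetric]) auto
  also have "m \<cdot> (f \<star> i) \<cdot> ((Ident C \<I> \<star> u) \<cdot> lu' \<I>) = (m \<cdot> (i \<star> u)) \<cdot> (f \<star> Ident C \<I>) \<cdot> lu' \<I>"
    by simp
  also have "\<dots> = (ru X \<cdot> (f \<star> Ident C \<I>)) \<cdot> lu' \<I>" unfolding unit_right by simp
  also have "ru X \<cdot> (f \<star> Ident C \<I>) = f \<cdot> lu \<I>" by (simp add: Runit_nat Lunit_Unit)
  finally show ?thesis by simp
qed

text \<open>In elements, \<open>(t 1) a = t (1 a) = t a\<close>. With the two preceding lemmas,
  points and module endomorphisms correspond bijectively.\<close>

lemma module_endo_eq_mult_by:
  assumes "module_endo t"
  shows "mult_by C A (t \<cdot> u) = t"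
proof -
  note [simp] = module_endo_simps(1-3)[OF assms]
  have "mult_by C A (t \<cdot> u) = (m \<cdot> (t \<star> i)) \<cdot> (u \<star> i) \<cdot> lu' X" by (simp add: mult_by_def)
  also have "\<dots> = t \<cdot> (m \<cdot> (u \<star> i)) \<cdot> lu' X"
    unfolding module_endo_simps(4)[OF assms, symmetric] by simp
  also have "\<dots> = t" by (simp add: unit_left)
  finally show ?thesis .
qed

lemma module_endo_Comp:
  assumes "module_endo t" "module_endo t'"
  shows "module_endo (t \<cdot> t')"
proof -
  note [simp] = module_endo_simps(1-3)[OF assms(1)] module_endo_simps(1-3)[OF assms(2)]
  have "(t \<cdot> t') \<cdot> m = t \<cdot> (t' \<cdot> m)" by simp
  also have "t' \<cdot> m = m \<cdot> (t' \<star> i)" by (rule module_endo_simps[OF assms(2)])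
  also have "t \<cdot> \<dots> = (t \<cdot> m) \<cdot> (t' \<star> i)" by simp
  also have "t \<cdot> m = m \<cdot> (t \<star> i)" by (rule module_endo_simps[OF assms(1)])
  finally show ?thesis by (simp add: module_endo_def Hom_def)
qed

text \<open>With \<open>t\<close> acting on the first factor and \<open>t'\<close> on the second,
  both composites send \<open>a b\<close> to \<open>(t a) (t' b)\<close>; then \<open>a\<close> is
  set to the unit.\<close>

lemma module_endo_commute:
  assumes "module_endo t" "module_endo t'"
  shows "t \<cdot> t' = t' \<cdot> t"
proof -
  note [simp] = module_endo_simps(1-3)[OF assms(1)] module_endo_simps(1-3)[OF assms(2)]
  have "(t \<cdot> t') \<cdot> m = t \<cdot> (t' \<cdot> m)" by simp
  also have "t' \<cdot> m = m \<cdot> (i \<star> t')"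
    using assms(2) module_endo_right[of t'] by (simp add: Hom_def)
  also have "t \<cdot> \<dots> = (t \<cdot> m) \<cdot> (i \<star> t')" by simp
  also have "t \<cdot> m = m \<cdot> (t \<star> i)" by (rule module_endo_simps[OF assms(1)])
  also have "(m \<cdot> (t \<star> i)) \<cdot> (i \<star> t') = (m \<cdot> (i \<star> t')) \<cdot> (t \<star> i)" by simp
  also have "m \<cdot> (i \<star> t') = t' \<cdot> m"
    using assms(2) module_endo_right[of t'] by (simp add: Hom_def)
  also have "(t' \<cdot> m) \<cdot> (t \<star> i) = t' \<cdot> (m \<cdot> (t \<star> i))" by simp
  also have "m \<cdot> (t \<star> i) = t \<cdot> m" by (rule module_endo_simps(4)[OF assms(1), symmetric])
  finally have "((t \<cdot> t') \<cdot> m) \<cdot> (u \<star> i) = (t' \<cdot> (t \<cdot> m)) \<cdot> (u \<star> i)" by simp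
  then have "(t \<cdot> t') \<cdot> lu X = (t' \<cdot> t) \<cdot> lu X" by (simp add: unit_left)
  then show ?thesis by (intro Iso_right_cancel[OF Lunit_iso, of X "t \<cdot> t'" "t' \<cdot> t"]) auto
qed

section \<open>Powers of the handle endomorphism and the generating function\<close>

definition xpow :: "nat \<Rightarrow> 'm" where
  "xpow n = ((\<lambda>g. x \<cdot> g) ^^ n) i"

lemma xpow_simps [simp]: "xpow 0 = i" "xpow (Suc n) = x \<cdot> xpow n"
  by (simp_all add: xpow_def)

lemma module_endo_xpow: "module_endo (xpow n)"
proof (induction n)
  case 0
  show ?case by (simp add: module_endo_def Hom_def)
next
  case (Suc n)
  then show ?case unfolding xpow_simps by (rule module_endo_Comp[OF module_endo_handle_endo])
qed

lemmas xpow_arr [simp] = module_endo_simps(1-3)[OF module_endo_xpow]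

text \<open>The inverse of \<open>c \<mapsto> Scale C c (Ident C \<I>)\<close> when
  \<open>End_unit_is_scalars\<close> holds; the same description occurs inside
  \<open>gen_fun\<close>.\<close>

definition unit_coord :: "'m \<Rightarrow> 'k" where
  "unit_coord f = (THE c. f = Scale C c (Ident C \<I>))"

lemma fps_nth_gen_fun: "fps_nth (gen_fun C A) n = unit_coord (ep \<cdot> (xpow n \<cdot> u))"
  by (simp add: gen_fun_def unit_coord_def xpow_def)

end

section \<open>The image of an idempotent\<close>

text \<open>Formulated with a module endomorphism \<open>p\<close> in place of a point; the
  corresponding point is \<open>p \<cdot> u\<close>.\<close>

locale frobenius_summand = frobenius_algebra C A
  for C :: "('o, 'm, 'k::field) ksmc" (structure) and A +
  fixes p B r s
  assumes module_endo_p: "module_endo p"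
    and splits_p: "splits C (Fobj A) p B r s"
begin

abbreviation "b \<equiv> Ident C B"
abbreviation "mB \<equiv> r \<cdot> m \<cdot> (s \<star> s)"
abbreviation "S \<equiv> summand C A (p \<cdot> u) B r s"

lemmas [simp] = splits_simps[OF splits_p] module_endo_simps(1-3)[OF module_endo_p]

section \<open>Sliding the idempotent through multiplication and pairing\<close>

lemma p_idem [simp]: "p \<cdot> p = p"
  using splits_simps(12)[OF splits_p, of p] splits_simps(8,11)[OF splits_p] by simp

lemma p_idem_comp [simp]: "\<lbrakk>k \<in> Arr C; Cod C k = X\<rbrakk> \<Longrightarrow> p \<cdot> (p \<cdot> k) = p \<cdot> k"
  using Comp_assoc'[of k p p] by simp

lemma p_mult: "p \<cdot> m = m \<cdot> (p \<star> i)" and p_mult': "p \<cdot> m = m \<cdot> (i \<star> p)"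
  using module_endo_p module_endo_right[of p] by (auto simp: module_endo_simps(4) Hom_def)

lemma p_mult_comp: "\<lbrakk>k \<in> Arr C; Cod C k = X \<boxtimes> X\<rbrakk> \<Longrightarrow> p \<cdot> (m \<cdot> k) = m \<cdot> ((p \<star> i) \<cdot> k)"
  using Comp_assoc'[of k m p] by (simp add: p_mult)

text \<open>\<open>p\<close> slides out of \<open>m\<close> and is absorbed by
  \<open>r \<cdot> p = r\<close>.\<close>

lemma r_mult: "r \<cdot> m \<cdot> (p \<star> i) = r \<cdot> m" and r_mult': "r \<cdot> m \<cdot> (i \<star> p) = r \<cdot> m"
  by (simp_all add: p_mult[symmetric] p_mult'[symmetric])

text \<open>Self-adjointness of \<open>p\<close>: it passes from one factor of \<open>m\<close> to
  the other.\<close>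

lemma ev_p: "ev \<cdot> (p \<star> i) = ev \<cdot> (i \<star> p)"
  by (simp add: Fpairing_def p_mult[symmetric] p_mult'[symmetric])

lemma ev_s_p: "ev \<cdot> (s \<star> p) = ev \<cdot> (s \<star> i)"
proof -
  have "ev \<cdot> (s \<star> p) = (ev \<cdot> (i \<star> p)) \<cdot> (s \<star> i)" by simp
  also have "\<dots> = ev \<cdot> (s \<star> i)" unfolding ev_p[symmetric] by simp
  finally show ?thesis .
qed

lemma ev_p_s: "ev \<cdot> (p \<star> s) = ev \<cdot> (i \<star> s)"
proof -
  have "ev \<cdot> (p \<star> s) = (ev \<cdot> (p \<star> i)) \<cdot> (i \<star> s)" by simp
  also have "\<dots> = ev \<cdot> (i \<star> s)" unfolding ev_p by simp
  finally show ?thesis .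
qed

section \<open>The Frobenius structure on the summand\<close>

lemma summand_sel [simp]:
  "Fobj S = B" "Fmult S = mB" "Funit S = r \<cdot> p \<cdot> u" "Fcounit S = ep \<cdot> s"
  by (simp_all add: summand_def)

text \<open>Each \<open>s \<cdot> r\<close> between two multiplications is \<open>p\<close>, which
  slides through \<open>m\<close> until \<open>r\<close> or \<open>s\<close> absorbs it; the axioms
  then follow from those of \<open>A\<close>.\<close>

lemma summand_algebra: "commutative_algebra_object C S"
proof -
  have "mB \<cdot> (mB \<star> b) = r \<cdot> (m \<cdot> (m \<star> i)) \<cdot> ((s \<star> s) \<star> s)"
    by (simp add: p_mult_comp)
  also note mult_assoc
  also have "r \<cdot> (m \<cdot> (i \<star> m) \<cdot> al X X X) \<cdot> ((s \<star> s) \<star> s) =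
      r \<cdot> m \<cdot> (i \<star> m) \<cdot> (al X X X \<cdot> ((s \<star> s) \<star> s))"
    by simp
  also have "al X X X \<cdot> ((s \<star> s) \<star> s) = (s \<star> (s \<star> s)) \<cdot> al B B B"
    by (rule Assoc_nat) auto
  also have "r \<cdot> m \<cdot> (i \<star> m) \<cdot> ((s \<star> (s \<star> s)) \<cdot> al B B B) = mB \<cdot> (b \<star> mB) \<cdot> al B B B"
    by (simp add: p_mult_comp)
  finally have assoc: "mB \<cdot> (mB \<star> b) = mB \<cdot> (b \<star> mB) \<cdot> al B B B" .
  have "mB \<cdot> ((r \<cdot> p \<cdot> u) \<star> b) = (r \<cdot> m \<cdot> (p \<star> i)) \<cdot> (u \<star> i) \<cdot> (Ident C \<I> \<star> s)"
    by simp
  also have "\<dots> = r \<cdot> (m \<cdot> (u \<star> i)) \<cdot> (Ident C \<I> \<star> s)" unfolding r_mult by simp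
  also have "\<dots> = lu B" by (simp add: unit_left Lunit_nat)
  finally have left: "mB \<cdot> ((r \<cdot> p \<cdot> u) \<star> b) = lu B" .
  have "mB \<cdot> (b \<star> (r \<cdot> p \<cdot> u)) = (r \<cdot> m \<cdot> (i \<star> p)) \<cdot> (i \<star> u) \<cdot> (s \<star> Ident C \<I>)"
    by simp
  also have "\<dots> = r \<cdot> (m \<cdot> (i \<star> u)) \<cdot> (s \<star> Ident C \<I>)" unfolding r_mult' by simp
  also have "\<dots> = ru B" by (simp add: unit_right Runit_nat)
  finally have right: "mB \<cdot> (b \<star> (r \<cdot> p \<cdot> u)) = ru B" .
  have [simp]: "Braid C B B \<in> Arr C" "Dom C (Braid C B B) = B \<boxtimes> B" "Cod C (Braid C B B) = B \<boxtimes> B"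
    using Braid_closed[of B B] by (simp_all add: Hom_def)
  have "mB \<cdot> Braid C B B = r \<cdot> m \<cdot> ((s \<star> s) \<cdot> Braid C B B)" by simp
  also have "(s \<star> s) \<cdot> Braid C B B = Braid C X X \<cdot> (s \<star> s)"
    using Braid_natural[of s B X s B X] by (simp add: Hom_def)
  also have "r \<cdot> m \<cdot> (Braid C X X \<cdot> (s \<star> s)) = r \<cdot> (m \<cdot> Braid C X X) \<cdot> (s \<star> s)" by simp
  also note mult_braid
  finally have comm: "mB \<cdot> Braid C B B = mB" .
  show ?thesis
    unfolding commutative_algebra_object_def Let_def summand_sel
    using assoc left right comm by (auto simp: Hom_def)
qed

lemma summand_pairing: "Fpairing C S = ev \<cdot> (s \<star> s)"
  unfolding Fpairing_def summand_sel by (simp add: p_mult_comp)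

text \<open>After naturality the pairing contains one \<open>p = s \<cdot> r\<close>, which
  disappears by self-adjointness; what is left is a zigzag of \<open>A\<close> between
  \<open>r\<close> and \<open>s\<close>.\<close>

lemma summand_dual_pair: "dual_pair C B B (ev \<cdot> (s \<star> s)) ((r \<star> r) \<cdot> co)"
proof -
  let ?I = "Ident C \<I>"
  have zz: "ru X \<cdot> (i \<star> ev) \<cdot> al X X X \<cdot> (co \<star> i) = lu X"
    and zz': "lu X \<cdot> (ev \<star> i) \<cdot> al' X X X \<cdot> (i \<star> co) = ru X"
    using dual_pair_copairing by (auto simp: dual_pair_def)
  have "ru B \<cdot> (b \<star> (ev \<cdot> (s \<star> s))) \<cdot> al B B B \<cdot> (((r \<star> r) \<cdot> co) \<star> b) =
      ru B \<cdot> (b \<star> (ev \<cdot> (s \<star> s))) \<cdot> (al B B B \<cdot> ((r \<star> r) \<star> b)) \<cdot> (co \<star> b)"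
    by simp
  also have "al B B B \<cdot> ((r \<star> r) \<star> b) = (r \<star> (r \<star> b)) \<cdot> al X X B"
    by (rule Assoc_nat) auto
  also have "ru B \<cdot> (b \<star> (ev \<cdot> (s \<star> s))) \<cdot> ((r \<star> (r \<star> b)) \<cdot> al X X B) \<cdot> (co \<star> b) =
      ru B \<cdot> (r \<star> (ev \<cdot> (p \<star> s))) \<cdot> al X X B \<cdot> (co \<star> b)"
    by simp
  also note ev_p_s
  also have "ru B \<cdot> (r \<star> (ev \<cdot> (i \<star> s))) \<cdot> al X X B \<cdot> (co \<star> b) =
      ru B \<cdot> (r \<star> ev) \<cdot> ((i \<star> (i \<star> s)) \<cdot> al X X B) \<cdot> (co \<star> b)"
    by simp
  also have "(i \<star> (i \<star> s)) \<cdot> al X X B = al X X X \<cdot> ((i \<star> i) \<star> s)"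
    by (rule Assoc_nat[symmetric]) auto
  also have "ru B \<cdot> (r \<star> ev) \<cdot> (al X X X \<cdot> ((i \<star> i) \<star> s)) \<cdot> (co \<star> b) =
      (ru B \<cdot> (r \<star> ?I)) \<cdot> (i \<star> ev) \<cdot> al X X X \<cdot> (co \<star> i) \<cdot> (?I \<star> s)"
    by simp
  also have "ru B \<cdot> (r \<star> ?I) = r \<cdot> ru X" by (rule Runit_nat) auto
  also have "(r \<cdot> ru X) \<cdot> (i \<star> ev) \<cdot> al X X X \<cdot> (co \<star> i) \<cdot> (?I \<star> s) =
      r \<cdot> (ru X \<cdot> (i \<star> ev) \<cdot> al X X X \<cdot> (co \<star> i)) \<cdot> (?I \<star> s)"
    by simp
  also note zz
  also have "r \<cdot> lu X \<cdot> (?I \<star> s) = lu B" by (simp add: Lunit_nat)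
  finally have 1: "ru B \<cdot> (b \<star> (ev \<cdot> (s \<star> s))) \<cdot> al B B B \<cdot> (((r \<star> r) \<cdot> co) \<star> b) = lu B" .
  have "lu B \<cdot> ((ev \<cdot> (s \<star> s)) \<star> b) \<cdot> al' B B B \<cdot> (b \<star> ((r \<star> r) \<cdot> co)) =
      lu B \<cdot> ((ev \<cdot> (s \<star> s)) \<star> b) \<cdot> (al' B B B \<cdot> (b \<star> (r \<star> r))) \<cdot> (b \<star> co)"
    by simp
  also have "al' B B B \<cdot> (b \<star> (r \<star> r)) = ((b \<star> r) \<star> r) \<cdot> al' B X X"
    by (rule Assoc_inv_nat[symmetric]) auto
  also have "lu B \<cdot> ((ev \<cdot> (s \<star> s)) \<star> b) \<cdot> (((b \<star> r) \<star> r) \<cdot> al' B X X) \<cdot> (b \<star> co) =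
      lu B \<cdot> ((ev \<cdot> (s \<star> p)) \<star> r) \<cdot> al' B X X \<cdot> (b \<star> co)"
    by simp
  also note ev_s_p
  also have "lu B \<cdot> ((ev \<cdot> (s \<star> i)) \<star> r) \<cdot> al' B X X \<cdot> (b \<star> co) =
      lu B \<cdot> (ev \<star> r) \<cdot> (((s \<star> i) \<star> i) \<cdot> al' B X X) \<cdot> (b \<star> co)"
    by simp
  also have "((s \<star> i) \<star> i) \<cdot> al' B X X = al' X X X \<cdot> (s \<star> (i \<star> i))"
    by (rule Assoc_inv_nat) auto
  also have "lu B \<cdot> (ev \<star> r) \<cdot> (al' X X X \<cdot> (s \<star> (i \<star> i))) \<cdot> (b \<star> co) =
      (lu B \<cdot> (?I \<star> r)) \<cdot> (ev \<star> i) \<cdot> al' X X X \<cdot> (i \<star> co) \<cdot> (s \<star> ?I)"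
    by simp
  also have "lu B \<cdot> (?I \<star> r) = r \<cdot> lu X" by (rule Lunit_nat) auto
  also have "(r \<cdot> lu X) \<cdot> (ev \<star> i) \<cdot> al' X X X \<cdot> (i \<star> co) \<cdot> (s \<star> ?I) =
      r \<cdot> (lu X \<cdot> (ev \<star> i) \<cdot> al' X X X \<cdot> (i \<star> co)) \<cdot> (s \<star> ?I)"
    by simp
  also note zz'
  also have "r \<cdot> ru X \<cdot> (s \<star> ?I) = ru B" by (simp add: Runit_nat)
  finally have 2: "lu B \<cdot> ((ev \<cdot> (s \<star> s)) \<star> b) \<cdot> al' B B B \<cdot> (b \<star> ((r \<star> r) \<cdot> co)) = ru B" .
  show ?thesis
    unfolding dual_pair_def using 1 2 by (auto simp: Hom_def)
qed

lemma summand_frobenius: "commutative_frobenius_algebra C S"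
  unfolding commutative_frobenius_algebra_def summand_pairing
  using summand_algebra summand_dual_pair by (auto simp: Hom_def)

section \<open>Handle endomorphism and generating function of the summand\<close>

sublocale B: frobenius_algebra C S
  by unfold_locales (rule summand_frobenius)

lemma summand_copairing: "Fcopairing C S = (r \<star> r) \<cdot> co"
  using dual_pair_coev_unique[OF summand_dual_pair] B.dual_pair_copairing
  unfolding summand_pairing summand_sel .

text \<open>The handle endomorphism of the summand multiplies by
  \<open>mB \<cdot> (r \<star> r) \<cdot> co\<close>; absorbing \<open>p\<close> turns this point
  into \<open>r \<cdot> m \<cdot> co\<close>, and naturality of the unitor extracts
  \<open>s\<close>.\<close>

lemma summand_handle_endo: "handle_endo C S = r \<cdot> x \<cdot> s"
proof -
  let ?h = "m \<cdot> co" and ?I = "Ident C \<I>"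
  have h: "mB \<cdot> (r \<star> r) \<cdot> co = r \<cdot> ?h"
  proof -
    have "mB \<cdot> (r \<star> r) \<cdot> co = (r \<cdot> m \<cdot> (p \<star> i)) \<cdot> (i \<star> p) \<cdot> co" by simp
    also have "\<dots> = (r \<cdot> m \<cdot> (i \<star> p)) \<cdot> co" unfolding r_mult by simp
    finally show ?thesis unfolding r_mult' by simp
  qed
  have "handle_endo C S = mB \<cdot> (b \<star> (mB \<cdot> (r \<star> r) \<cdot> co)) \<cdot> ru' B"
    using B.handle_endo_eq unfolding summand_sel summand_copairing .
  also note h
  also have "mB \<cdot> (b \<star> (r \<cdot> ?h)) \<cdot> ru' B = (r \<cdot> m \<cdot> (i \<star> p)) \<cdot> (i \<star> ?h) \<cdot> ((s \<star> ?I) \<cdot> ru' B)"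
    by simp
  also note r_mult'
  also have "(s \<star> ?I) \<cdot> ru' B = ru' X \<cdot> s" by (rule Runit_inv_nat) auto
  finally show ?thesis by (simp add: handle_endo_eq)
qed

text \<open>Successive factors meet in \<open>s \<cdot> r = p\<close>, which commutes with
  \<open>xpow n\<close> and is absorbed by \<open>s\<close>.\<close>

lemma summand_xpow: "B.xpow n = r \<cdot> xpow n \<cdot> s"
proof (induction n)
  case 0
  then show ?case by simp
next
  case (Suc n)
  have "B.xpow (Suc n) = r \<cdot> x \<cdot> (p \<cdot> xpow n) \<cdot> s"
    using Suc by (simp add: summand_handle_endo)
  also have "p \<cdot> xpow n = xpow n \<cdot> p"
    by (rule module_endo_commute[OF module_endo_p module_endo_xpow])
  finally show ?case by simp
qed

text \<open>The counit brings \<open>s\<close> and the unit brings \<open>r\<close>, so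
  \<open>p\<close> stands on both sides of \<open>xpow n\<close>; commuting merges the
  copies.\<close>

lemma fps_nth_gen_fun_summand: "fps_nth (gen_fun C S) n = unit_coord (ep \<cdot> (xpow n \<cdot> (p \<cdot> u)))"
proof -
  have "fps_nth (gen_fun C S) n = unit_coord (ep \<cdot> (p \<cdot> xpow n) \<cdot> p \<cdot> u)"
    by (simp add: B.fps_nth_gen_fun summand_xpow unit_coord_def B.unit_coord_def)
  also have "p \<cdot> xpow n = xpow n \<cdot> p"
    by (rule module_endo_commute[OF module_endo_p module_endo_xpow])
  finally show ?thesis by simp
qed

end

section \<open>Linear recurrences and partial fractions\<close>

text \<open>The numbers \<open>L (monom 1 n * g)\<close> obey the linear recurrence with
  characteristic polynomial \<open>V\<close>, because combining them with the coefficients of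
  \<open>V\<close> gives \<open>L\<close> of a multiple of \<open>g * V\<close>. Multiplying the
  series by the reversed polynomial forms exactly these combinations from index
  \<open>degree V\<close> on.\<close>

lemma linear_functional_recurrence:
  fixes L :: "'k::field poly \<Rightarrow> 'k"
  assumes L_add: "\<And>p q. L (p + q) = L p + L q" and L_smult: "\<And>c p. L (smult c p) = c * L p"
    and L_mult: "\<And>n. L (monom 1 n * (g * V)) = 0"
  shows "\<exists>v. Abs_fps (\<lambda>n. L (monom 1 n * g)) * fps_of_poly (reflect_poly V) = fps_of_poly v \<and>
    (v = 0 \<or> degree v < degree V)"
proof -
  let ?d = "degree V" and ?F = "Abs_fps (\<lambda>n. L (monom 1 n * g))"
  let ?P = "?F * fps_of_poly (reflect_poly V)"
  \<comment> \<open>The instance at \<open>0\<close> supplies \<open>L 0 = 0\<close> for empty and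
    infinite index sets.\<close>
  have L_sum: "L (sum f I) = (\<Sum>i\<in>I. L (f i))" for f :: "nat \<Rightarrow> 'k poly" and I
    using L_smult[of 0 0] by (induction I rule: infinite_finite_induct) (auto simp: L_add)
  have zero: "fps_nth ?P n = 0" if "n \<ge> ?d" for n
  proof -
    have "fps_nth ?P n = (\<Sum>k=0..n. L (monom 1 k * g) * coeff (reflect_poly V) (n - k))"
      by (simp add: fps_mult_nth)
    \<comment> \<open>The reversed polynomial has no coefficients above \<open>?d\<close>.\<close>
    also have "\<dots> = (\<Sum>k=n-?d..n. L (monom 1 k * g) * coeff (reflect_poly V) (n - k))"
      by (rule sum.mono_neutral_right) (auto simp: coeff_reflect_poly)
    \<comment> \<open>With \<open>k = n - ?d + j\<close>, position \<open>n - k\<close> of the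
      reversed polynomial is position \<open>j\<close> of \<open>V\<close>.\<close>
    also have "\<dots> = (\<Sum>j\<le>?d. L (monom 1 (n - ?d + j) * g) * coeff V j)"
      by (rule sum.reindex_bij_witness[of _ "\<lambda>j. n - ?d + j" "\<lambda>k. k - (n - ?d)"])
        (use that in \<open>auto simp: coeff_reflect_poly intro!: arg_cong[where f = "coeff V"]\<close>)
    also have "\<dots> = L (\<Sum>j\<le>?d. smult (coeff V j) (monom 1 (n - ?d + j) * g))"
      by (simp add: L_sum L_smult mult.commute)
    also have "(\<Sum>j\<le>?d. smult (coeff V j) (monom 1 (n - ?d + j) * g)) =
        monom 1 (n - ?d) * (g * (\<Sum>j\<le>?d. monom (coeff V j) j))"
    proof -
      have "smult (coeff V j) (monom 1 (n - ?d + j) * g) = monom 1 (n - ?d) * (g * monom (coeff V j) j)" for j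
      proof -
        have "smult (coeff V j) (monom 1 (n - ?d + j) * g) = monom (coeff V j) (n - ?d + j) * g"
          by (simp add: mult_smult_left[symmetric] smult_monom del: mult_smult_left)
        also have "monom (coeff V j) (n - ?d + j) = monom 1 (n - ?d) * monom (coeff V j) j"
          by (simp add: mult_monom)
        finally show ?thesis by (simp add: mult_ac)
      qed
      then show ?thesis by (simp add: sum_distrib_left)
    qed
    also have "(\<Sum>j\<le>?d. monom (coeff V j) j) = V" by (rule poly_as_sum_of_monoms)
    finally show ?thesis by (simp add: L_mult)
  qed
  define v where "v = (\<Sum>n<?d. monom (fps_nth ?P n) n)"
  have coeff_v: "coeff v n = (if n < ?d then fps_nth ?P n else 0)" for n
    by (simp add: v_def coeff_sum sum.delta')
  have "?P = fps_of_poly v"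
    by (rule fps_ext) (simp add: coeff_v zero del: fps_mult_nth)
  moreover have "v = 0 \<or> degree v < ?d"
    using degree_lessI[of v ?d] coeff_v by auto
  ultimately show ?thesis by blast
qed

text \<open>Reversing twice removes the power of \<open>T\<close> in \<open>p\<close>:
  \<open>T\<close> itself reverses to \<open>1\<close>, and reversal is involutive when the constant
  term is nonzero.\<close>

lemma reflect_poly_twice:
  fixes p :: "'k::field poly"
  assumes "p \<noteq> 0"
  shows "reflect_poly (reflect_poly p) dvd p"
proof -
  obtain q where q: "p = [:- 0, 1:] ^ order 0 p * q" "\<not> [:- 0, 1:] dvd q"
    using order_decomp[OF assms] by blast
  have "coeff q 0 \<noteq> 0" using q(2) by (simp add: dvd_iff_poly_eq_0 poly_0_coeff_0)
  moreover have "reflect_poly [:0, 1 :: 'k:] = 1"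
    by (simp add: reflect_poly_def)
  ultimately have "reflect_poly (reflect_poly p) = q"
    by (subst q(1)) (simp add: reflect_poly_mult reflect_poly_power)
  then show ?thesis by (metis dvd_triv_right q(1))
qed

text \<open>Coprimality is available for \<open>U1\<close> and \<open>U2\<close> rather than their
  reversals, so after clearing denominators the equation is reversed back; then \<open>U2\<close>
  divides the reversal of \<open>v1 - w1\<close>, whose degree is too small unless it
  vanishes.\<close>

lemma partial_fractions_unique:
  fixes U1 U2 :: "'k::field poly"
  assumes "a * U1 + b * U2 = 1" "U1 \<noteq> 0" "coeff U2 0 \<noteq> 0"
    and "partial_fractions Z (reflect_poly U2) (reflect_poly U1) v1 v2"
    and "partial_fractions Z (reflect_poly U2) (reflect_poly U1) w1 w2"
  shows "v1 = w1 \<and> v2 = w2"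
proof -
  let ?Q1 = "reflect_poly U2" and ?Q2 = "reflect_poly U1"
  have U2: "U2 \<noteq> 0" using assms(3) by auto
  have clear: "Z * fps_of_poly ?Q1 * fps_of_poly ?Q2 = fps_of_poly (y1 * ?Q2 + y2 * ?Q1)"
    if "partial_fractions Z ?Q1 ?Q2 y1 y2" for y1 y2
  proof -
    let ?f = "fps_of_poly :: 'k poly \<Rightarrow> _"
    \<comment> \<open>The constant term of a reversed polynomial is the original leading
      coefficient, so both denominators are invertible series.\<close>
    have nz: "fps_nth (?f ?Q1) 0 \<noteq> 0" "fps_nth (?f ?Q2) 0 \<noteq> 0"
      using U2 assms(2) by simp_all
    have "Z * ?f ?Q1 * ?f ?Q2 =
        ?f y1 * ?f ?Q2 * (inverse (?f ?Q1) * ?f ?Q1) + ?f y2 * ?f ?Q1 * (inverse (?f ?Q2) * ?f ?Q2)"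
      using that nz by (simp add: partial_fractions_def fps_divide_unit algebra_simps)
    then show ?thesis
      using nz by (simp add: inverse_mult_eq_1 fps_of_poly_add fps_of_poly_mult)
  qed
  have "v1 * ?Q2 + v2 * ?Q1 = w1 * ?Q2 + w2 * ?Q1"
    using clear[OF assms(4)] clear[OF assms(5)] by (simp add: fps_of_poly_eq_iff)
  then have eq: "(v1 - w1) * ?Q2 = (w2 - v2) * ?Q1" by (simp add: algebra_simps)
  have "reflect_poly (v1 - w1) * reflect_poly ?Q2 = reflect_poly (w2 - v2) * U2"
    using arg_cong[OF eq, of reflect_poly] assms(3) by (simp add: reflect_poly_mult)
  then have "U2 dvd reflect_poly (v1 - w1) * reflect_poly ?Q2" by simp
  \<comment> \<open>Reversing \<open>?Q2\<close> recovers only a divisor of \<open>U1\<close> if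
    \<open>T\<close> divides \<open>U1\<close>; a divisor is enough.\<close>
  then have "U2 dvd reflect_poly (v1 - w1) * U1"
    using reflect_poly_twice[OF assms(2)] by (meson dvd_refl dvd_trans mult_dvd_mono)
  then have "U2 dvd a * (reflect_poly (v1 - w1) * U1) + reflect_poly (v1 - w1) * b * U2"
    by (rule dvd_add[OF dvd_mult]) simp
  also have "\<dots> = reflect_poly (v1 - w1) * (a * U1 + b * U2)" by (simp add: algebra_simps)
  finally have "U2 dvd reflect_poly (v1 - w1)" by (simp add: assms(1))
  \<comment> \<open>\<open>?Q1\<close> has the degree of \<open>U2\<close> because the constant term
    of \<open>U2\<close> is nonzero.\<close>
  moreover have "v1 - w1 = 0 \<or> degree (v1 - w1) < degree U2"
  proof -
    have "v1 = 0 \<or> degree v1 < degree U2" "w1 = 0 \<or> degree w1 < degree U2"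
      using assms(3-5) by (auto simp: partial_fractions_def)
    then show ?thesis by (metis degree_diff_less diff_0 diff_zero degree_minus)
  qed
  ultimately have "v1 - w1 = 0"
    using dvd_imp_degree_le[of U2 "reflect_poly (v1 - w1)"] degree_reflect_poly_le[of "v1 - w1"]
    by (metis leD le_trans reflect_poly_eq_0_iff)
  with eq U2 show ?thesis by simp
qed

section \<open>Polynomials in the handle\<close>

context frobenius_algebra
begin

section \<open>The algebra of points\<close>

abbreviation "P \<equiv> point_alg C A"
abbreviation "x0 \<equiv> handle C A"

text \<open>\<open>Hom_space\<close> and \<open>point_alg\<close> share carrier, zero, addition and
  scaling, which are what the module axioms concern, so unfolding transfers the axioms.\<close>

sublocale P: Module.module class_ring P
proof -
  interpret H: vectorspace class_ring "Hom_space C \<I> X"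
    by (rule Hom_vectorspace) auto
  note M = H.module_axioms[unfolded Module.module_def abelian_group_def abelian_monoid_def
      abelian_group_axioms_def Module.module_axioms_def]
  show "Module.module class_ring P"
    unfolding Module.module_def abelian_group_def abelian_monoid_def abelian_group_axioms_def Module.module_axioms_def
    using M by (simp add: Hom_space_def point_alg_def)
qed

lemma point_alg_sel: "carrier P = Hom C \<I> X" "add P = Plus C" "module.smult P = Scale C" "one P = u"
  by (simp_all add: point_alg_def)

text \<open>Naturality of the left unitor brings products of points into the calculus of module
  endomorphisms.\<close>

lemma point_alg_mult: "\<lbrakk>f \<in> carrier P; g \<in> carrier P\<rbrakk> \<Longrightarrow> f \<otimes>\<^bsub>P\<^esub> g = mult_by C A f \<cdot> g"
proof -
  assume "f \<in> carrier P" "g \<in> carrier P"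
  then have [simp]: "f \<in> Arr C" "Dom C f = \<I>" "Cod C f = X" "g \<in> Arr C" "Dom C g = \<I>" "Cod C g = X"
    by (auto simp: point_alg_sel Hom_def)
  have "mult_by C A f \<cdot> g = m \<cdot> (f \<star> i) \<cdot> (lu' X \<cdot> g)" by (simp add: mult_by_def)
  also have "lu' X \<cdot> g = (Ident C \<I> \<star> g) \<cdot> lu' \<I>"
    by (rule Lunit_inv_nat[symmetric]) auto
  finally show ?thesis by (simp add: point_alg_def)
qed

lemma point_algI [simp, intro]: "\<lbrakk>f \<in> Arr C; Dom C f = \<I>; Cod C f = X\<rbrakk> \<Longrightarrow> f \<in> carrier P"
  and point_algD: "f \<in> carrier P \<Longrightarrow> f \<in> Arr C" "f \<in> carrier P \<Longrightarrow> Dom C f = \<I>" "f \<in> carrier P \<Longrightarrow> Cod C f = X"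
  by (auto simp: point_alg_sel Hom_def)

lemma endo_closed [simp]: "\<lbrakk>t \<in> Hom C X X; f \<in> carrier P\<rbrakk> \<Longrightarrow> t \<cdot> f \<in> carrier P"
  unfolding point_alg_sel by (rule Comp_closed)

lemma endo_smult: "\<lbrakk>t \<in> Hom C X X; f \<in> carrier P\<rbrakk> \<Longrightarrow> t \<cdot> (c \<odot>\<^bsub>P\<^esub> f) = c \<odot>\<^bsub>P\<^esub> (t \<cdot> f)"
  unfolding point_alg_sel by (rule Comp_Scale_right)

lemma endo_add:
  "\<lbrakk>t \<in> Hom C X X; f \<in> carrier P; g \<in> carrier P\<rbrakk> \<Longrightarrow> t \<cdot> (f \<oplus>\<^bsub>P\<^esub> g) = (t \<cdot> f) \<oplus>\<^bsub>P\<^esub> (t \<cdot> g)"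
  unfolding point_alg_sel by (rule Comp_Plus_right)

declare class_ring_simps [simp]

lemma smult_zero: "f \<in> carrier P \<Longrightarrow> 0 \<odot>\<^bsub>P\<^esub> f = \<zero>\<^bsub>P\<^esub>"
  using P.smult_l_null[of f] by simp

lemma endo_zero: "t \<in> Hom C X X \<Longrightarrow> t \<cdot> \<zero>\<^bsub>P\<^esub> = \<zero>\<^bsub>P\<^esub>"
  using endo_smult[of t u 0] by (simp add: smult_zero)

lemma handle_endo_Hom [simp]: "x \<in> Hom C X X" and xpow_Hom [simp]: "xpow n \<in> Hom C X X"
  by (simp_all add: Hom_def)

lemma unit_point_alg [simp]: "u \<in> carrier P" by auto

text \<open>The monoid power adds factors on the right and \<open>xpow\<close> adds them on the
  left; module endomorphisms commute.\<close>

lemma handle_pow: "x0 [^]\<^bsub>P\<^esub> n = xpow n \<cdot> u"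
proof (induction n)
  case 0
  show ?case by (simp add: nat_pow_def point_alg_sel)
next
  case (Suc n)
  have "x0 [^]\<^bsub>P\<^esub> Suc n = (xpow n \<cdot> u) \<otimes>\<^bsub>P\<^esub> x0" using Suc by (simp add: nat_pow_def)
  also have "\<dots> = xpow n \<cdot> x \<cdot> u"
    by (simp add: point_alg_mult handle_def module_endo_eq_mult_by[OF module_endo_xpow])
  also have "\<dots> = (xpow n \<cdot> x) \<cdot> u" by simp
  also have "xpow n \<cdot> x = x \<cdot> xpow n"
    by (rule module_endo_commute[OF module_endo_xpow module_endo_handle_endo])
  finally show ?case by simp
qed

section \<open>Evaluation of polynomials at the handle\<close>

abbreviation peval :: "'k poly \<Rightarrow> 'm" where
  "peval q \<equiv> poly_eval P q x0"

lemma handle_endo_finsum: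
  assumes "f \<in> {..n::nat} \<rightarrow> carrier P"
  shows "x \<cdot> finsum P f {..n} = finsum P (\<lambda>k. x \<cdot> f k) {..n}"
  using assms
proof (induction n)
  case 0
  then show ?case by (simp add: Pi_def)
next
  case (Suc n)
  then have f: "f \<in> {..n} \<rightarrow> carrier P" "f (Suc n) \<in> carrier P" "f \<in> {..Suc n} \<rightarrow> carrier P" by auto
  then have g: "(\<lambda>k. x \<cdot> f k) \<in> {..Suc n} \<rightarrow> carrier P" by (auto simp: Pi_def)
  show ?case
    unfolding P.finsum_Suc[OF f(3)] P.finsum_Suc[OF g] Suc.IH[OF f(1), symmetric]
    using f by (intro endo_add P.finsum_closed) auto
qed

lemma peval_closed [simp]: "peval q \<in> carrier P"
  unfolding poly_eval_def handle_pow by (rule P.finsum_closed) auto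

lemma peval_0 [simp]: "peval 0 = \<zero>\<^bsub>P\<^esub>"
  by (simp add: poly_eval_def handle_pow smult_zero)

text \<open>The Horner rule, on which the inductions over polynomials rest.\<close>

lemma peval_pCons: "peval (pCons a q) = (a \<odot>\<^bsub>P\<^esub> u) \<oplus>\<^bsub>P\<^esub> (x \<cdot> peval q)"
\<comment> \<open>For \<open>q = 0\<close> the degree of \<open>pCons a q\<close> is not one more
  than that of \<open>q\<close>, so the index shift fails.\<close>
proof (cases "q = 0")
  case True
  then have "peval (pCons a q) = a \<odot>\<^bsub>P\<^esub> u" by (simp add: poly_eval_def handle_pow)
  then show ?thesis using True by (simp add: endo_zero)
next
  case False
  let ?f = "\<lambda>k. coeff (pCons a q) k \<odot>\<^bsub>P\<^esub> (xpow k \<cdot> u)"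
  have "peval (pCons a q) = finsum P ?f {..Suc (degree q)}"
    using False by (simp add: poly_eval_def handle_pow)
  also have "\<dots> = finsum P (\<lambda>k. ?f (Suc k)) {..degree q} \<oplus>\<^bsub>P\<^esub> ?f 0"
    by (rule P.finsum_Suc2) auto
  also have "(\<lambda>k. ?f (Suc k)) = (\<lambda>k. x \<cdot> (coeff q k \<odot>\<^bsub>P\<^esub> (xpow k \<cdot> u)))"
    by (simp add: endo_smult)
  also have "finsum P \<dots> {..degree q} = x \<cdot> peval q"
    by (subst handle_endo_finsum[symmetric]) (auto simp: poly_eval_def handle_pow)
  finally show ?thesis by (simp add: P.a_comm)
qed

lemma peval_1: "peval 1 = u"
  by (simp add: one_pCons peval_pCons endo_zero P.smult_one[simplified])

lemma peval_add: "peval (p + q) = peval p \<oplus>\<^bsub>P\<^esub> peval q"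
proof (induction p q rule: poly_induct2)
  case 0
  show ?case by simp
next
  case (pCons a p b q)
  have [simp]: "(a + b) \<odot>\<^bsub>P\<^esub> u = (a \<odot>\<^bsub>P\<^esub> u) \<oplus>\<^bsub>P\<^esub> (b \<odot>\<^bsub>P\<^esub> u)"
    using P.smult_l_distr[of a b u] by simp
  show ?case
    by (simp add: peval_pCons pCons.IH endo_add P.a_ac)
qed

lemma peval_smult: "peval (smult c p) = c \<odot>\<^bsub>P\<^esub> peval p"
proof (induction p)
  case 0
  show ?case using P.smult_r_null[of c] by simp
next
  case (pCons a p)
  have "(c * a) \<odot>\<^bsub>P\<^esub> u = c \<odot>\<^bsub>P\<^esub> (a \<odot>\<^bsub>P\<^esub> u)"
    using P.smult_assoc1[of c a u] by simp
  then show ?case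
    using P.smult_r_distr[of c "a \<odot>\<^bsub>P\<^esub> u" "x \<cdot> peval p"]
    by (simp add: peval_pCons pCons.IH endo_smult)
qed

lemma mult_by_add:
  assumes "f \<in> carrier P" "g \<in> carrier P" "h \<in> carrier P"
  shows "mult_by C A (f \<oplus>\<^bsub>P\<^esub> g) \<cdot> h = (mult_by C A f \<cdot> h) \<oplus>\<^bsub>P\<^esub> (mult_by C A g \<cdot> h)"
proof -
  note [simp] = point_algD[OF assms(1)] point_algD[OF assms(2)] point_algD[OF assms(3)]
  have "f \<oplus>\<^bsub>P\<^esub> g \<in> carrier P" using assms by simp
  note [simp] = point_algD[OF this]
  have "mult_by C A (f \<oplus>\<^bsub>P\<^esub> g) \<cdot> h = m \<cdot> ((f \<oplus>\<^bsub>P\<^esub> g) \<star> i) \<cdot> (lu' X \<cdot> h)"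
    by (simp add: mult_by_def)
  also have "(f \<oplus>\<^bsub>P\<^esub> g) \<star> i = Plus C (f \<star> i) (g \<star> i)"
    unfolding point_alg_sel by (rule Tarr_Plus_left[of _ \<I> X _ _ X X]) (auto simp: Hom_def)
  also have "Plus C (f \<star> i) (g \<star> i) \<cdot> (lu' X \<cdot> h) =
      Plus C ((f \<star> i) \<cdot> (lu' X \<cdot> h)) ((g \<star> i) \<cdot> (lu' X \<cdot> h))"
    by (rule Comp_Plus_left[of _ \<I> "\<I> \<boxtimes> X" _ "X \<boxtimes> X"]) (auto simp: Hom_def)
  also have "m \<cdot> \<dots> = Plus C (m \<cdot> ((f \<star> i) \<cdot> (lu' X \<cdot> h))) (m \<cdot> ((g \<star> i) \<cdot> (lu' X \<cdot> h)))"
    by (rule Comp_Plus_right[of _ \<I> "X \<boxtimes> X" _ _ X]) (auto simp: Hom_def)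
  finally show ?thesis by (simp add: mult_by_def point_alg_sel)
qed

lemma mult_by_smult:
  assumes "f \<in> carrier P" "h \<in> carrier P"
  shows "mult_by C A (c \<odot>\<^bsub>P\<^esub> f) \<cdot> h = c \<odot>\<^bsub>P\<^esub> (mult_by C A f \<cdot> h)"
proof -
  note [simp] = point_algD[OF assms(1)] point_algD[OF assms(2)]
  have "c \<odot>\<^bsub>P\<^esub> f \<in> carrier P" using assms by simp
  note [simp] = point_algD[OF this]
  have "mult_by C A (c \<odot>\<^bsub>P\<^esub> f) \<cdot> h = m \<cdot> ((c \<odot>\<^bsub>P\<^esub> f) \<star> i) \<cdot> (lu' X \<cdot> h)"
    by (simp add: mult_by_def)
  also have "(c \<odot>\<^bsub>P\<^esub> f) \<star> i = Scale C c (f \<star> i)"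
    unfolding point_alg_sel by (rule Tarr_Scale_left[of _ \<I> X _ X X]) (auto simp: Hom_def)
  also have "Scale C c (f \<star> i) \<cdot> (lu' X \<cdot> h) = Scale C c ((f \<star> i) \<cdot> (lu' X \<cdot> h))"
    by (rule Comp_Scale_left[of _ \<I> "\<I> \<boxtimes> X" _ "X \<boxtimes> X"]) (auto simp: Hom_def)
  also have "m \<cdot> \<dots> = Scale C c (m \<cdot> ((f \<star> i) \<cdot> (lu' X \<cdot> h)))"
    by (rule Comp_Scale_right[of _ \<I> "X \<boxtimes> X" _ X]) (auto simp: Hom_def)
  finally show ?thesis by (simp add: mult_by_def point_alg_sel)
qed

lemma mult_by_Hom [simp]: "f \<in> carrier P \<Longrightarrow> mult_by C A f \<in> Hom C X X"
  using module_endo_mult_by[of f] by (simp add: point_alg_sel module_endo_def)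

text \<open>Both sides are module endomorphisms with the same value at the unit.\<close>

lemma mult_by_comp:
  assumes "module_endo t" "f \<in> carrier P"
  shows "mult_by C A (t \<cdot> f) = t \<cdot> mult_by C A f"
proof -
  note [simp] = module_endo_simps(1-3)[OF assms(1)] point_algD[OF assms(2)]
  have "mult_by C A ((t \<cdot> mult_by C A f) \<cdot> u) = t \<cdot> mult_by C A f"
    using assms by (intro module_endo_eq_mult_by module_endo_Comp module_endo_mult_by) (auto simp: point_alg_sel)
  then show ?thesis using assms mult_by_unit[of f] by (simp add: point_alg_sel)
qed

text \<open>Induction by the Horner rule: \<open>mult_by\<close> is linear in its point and lets
  \<open>x\<close> be pulled out.\<close>

lemma peval_mult: "peval (p * q) = mult_by C A (peval p) \<cdot> peval q"
proof (induction p)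
  case 0
  have "mult_by C A \<zero>\<^bsub>P\<^esub> \<cdot> peval q = 0 \<odot>\<^bsub>P\<^esub> (mult_by C A u \<cdot> peval q)"
    using mult_by_smult[of u "peval q" 0] by (simp add: smult_zero)
  then show ?case by (simp add: smult_zero)
next
  case (pCons a p)
  note [simp] = point_algD[OF peval_closed]
  have u: "mult_by C A u = i"
    using module_endo_eq_mult_by[OF module_endo_xpow[of 0]] by simp
  have "peval (pCons a p * q) = (a \<odot>\<^bsub>P\<^esub> peval q) \<oplus>\<^bsub>P\<^esub> (x \<cdot> peval (p * q))"
    by (simp add: peval_add peval_smult peval_pCons smult_zero)
  also have "\<dots> = mult_by C A (peval (pCons a p)) \<cdot> peval q"
    by (simp add: pCons.IH peval_pCons mult_by_add mult_by_smult u
        mult_by_comp[OF module_endo_handle_endo])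
  finally show ?case .
qed

text \<open>Lets \<open>x\<close> act as multiplication by \<open>T\<close>, so that coefficients of
  generating functions become values of one functional on polynomials.\<close>

lemma xpow_peval: "xpow n \<cdot> peval q = peval (monom 1 n * q)"
proof (induction n)
  case 0
  note [simp] = point_algD[OF peval_closed]
  show ?case by (simp add: monom_0)
next
  case (Suc n)
  note [simp] = point_algD[OF peval_closed]
  show ?case by (simp add: monom_Suc Suc.IH[symmetric] peval_pCons smult_zero)
qed

section \<open>Summands cut out by polynomials in the handle\<close>

lemma peval_multiple:
  assumes "peval U = \<zero>\<^bsub>P\<^esub>" "U dvd q"
  shows "peval q = \<zero>\<^bsub>P\<^esub>"
proof -
  obtain k where "q = k * U" using assms(2) by (metis dvdE mult.commute)
  then show ?thesis by (simp add: peval_mult assms(1) endo_zero)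
qed

text \<open>\<open>mult_by C A (peval g)\<close> is a module endomorphism with value
  \<open>peval g\<close> at the unit, so the results on split idempotents apply to it.\<close>

lemma gen_fun_summand:
  assumes "peval (g * g) = peval g" "splits C X (mult_by C A (peval g)) B r s"
  shows "commutative_frobenius_algebra C (summand C A (peval g) B r s)"
    and "gen_fun C (summand C A (peval g) B r s) =
      Abs_fps (\<lambda>n. unit_coord (ep \<cdot> peval (monom 1 n * g)))"
proof -
  have g: "peval g \<in> Hom C \<I> X" using peval_closed[of g] unfolding point_alg_sel .
  interpret frobenius_summand C A "mult_by C A (peval g)" B r s
    by unfold_locales (fact module_endo_mult_by[OF g] assms(2))+
  have eq: "mult_by C A (peval g) \<cdot> u = peval g" by (rule mult_by_unit[OF g])
  show "commutative_frobenius_algebra C (summand C A (peval g) B r s)"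
    using summand_frobenius unfolding eq .
  show "gen_fun C (summand C A (peval g) B r s) =
      Abs_fps (\<lambda>n. unit_coord (ep \<cdot> peval (monom 1 n * g)))"
    using fps_nth_gen_fun_summand unfolding eq xpow_peval by (intro fps_ext) simp
qed

text \<open>\<open>mult_by\<close> turns products of points into composites, so \<open>?p\<close> is
  idempotent because \<open>peval g\<close> is, and the Karoubian category splits it.\<close>

lemma splits_exists:
  assumes "karoubian C" "peval (g * g) = peval g"
  shows "\<exists>B r s. splits C X (mult_by C A (peval g)) B r s"
proof -
  let ?p = "mult_by C A (peval g)"
  have g: "peval g \<in> Hom C \<I> X" using peval_closed[of g] unfolding point_alg_sel .
  have "?p \<cdot> ?p = mult_by C A (?p \<cdot> peval g)"
    by (rule mult_by_comp[OF module_endo_mult_by[OF g] peval_closed, symmetric])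
  also have "?p \<cdot> peval g = peval g" using assms(2) unfolding peval_mult .
  finally have "?p \<cdot> ?p = ?p" .
  moreover have "?p \<in> Hom C X X" by simp
  ultimately show ?thesis using assms(1) unfolding karoubian_def by auto
qed

section \<open>The counit as a linear functional on polynomials\<close>

lemma unit_coord_linear:
  assumes "End_unit_is_scalars C"
  shows "f \<in> Hom C \<I> \<I> \<Longrightarrow> g \<in> Hom C \<I> \<I> \<Longrightarrow> unit_coord (Plus C f g) = unit_coord f + unit_coord g"
    and "f \<in> Hom C \<I> \<I> \<Longrightarrow> unit_coord (Scale C c f) = c * unit_coord f"
proof -
  interpret H: vectorspace class_ring "Hom_space C \<I> \<I>"
    by (rule Hom_vectorspace) auto
  let ?I = "Ident C \<I>"
  note b = assms[unfolded End_unit_is_scalars_def bij_betw_def]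
  have coord: "unit_coord (Scale C c ?I) = c" for c
    unfolding unit_coord_def using b by (intro the_equality) (auto simp: inj_on_def)
  have repr: "\<exists>c. f = Scale C c ?I" if "f \<in> Hom C \<I> \<I>" for f
    using b that by blast
  have I: "?I \<in> carrier (Hom_space C \<I> \<I>)" by (simp add: Hom_space_def Hom_def)
  have add: "Scale C (c + d) ?I = Plus C (Scale C c ?I) (Scale C d ?I)" for c d
    using H.smult_l_distr[of c d ?I] I by (simp add: Hom_space_def)
  have mult: "Scale C (c * d) ?I = Scale C c (Scale C d ?I)" for c d
    using H.smult_assoc1[of c d ?I] I by (simp add: Hom_space_def)
  show "unit_coord (Plus C f g) = unit_coord f + unit_coord g"
    if "f \<in> Hom C \<I> \<I>" "g \<in> Hom C \<I> \<I>"
    using repr[OF that(1)] repr[OF that(2)] by (auto simp: coord add[symmetric])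
  show "unit_coord (Scale C c f) = c * unit_coord f" if "f \<in> Hom C \<I> \<I>"
    using repr[OF that] by (auto simp: coord mult[symmetric])
qed

lemma peval_coord_linear:
  assumes "End_unit_is_scalars C"
  shows "unit_coord (ep \<cdot> peval (p + q)) = unit_coord (ep \<cdot> peval p) + unit_coord (ep \<cdot> peval q)"
    and "unit_coord (ep \<cdot> peval (smult c p)) = c * unit_coord (ep \<cdot> peval p)"
proof -
  have ep: "ep \<in> Hom C X \<I>" by (simp add: Hom_def)
  have pe: "peval q \<in> Hom C \<I> X" for q using peval_closed[of q] unfolding point_alg_sel .
  note cl = Comp_closed[OF pe ep]
  have "ep \<cdot> peval (p + q) = Plus C (ep \<cdot> peval p) (ep \<cdot> peval q)"
    unfolding peval_add point_alg_sel by (rule Comp_Plus_right[OF pe pe ep])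
  then show "unit_coord (ep \<cdot> peval (p + q)) = unit_coord (ep \<cdot> peval p) + unit_coord (ep \<cdot> peval q)"
    using unit_coord_linear(1)[OF assms cl cl] by simp
  have "ep \<cdot> peval (smult c p) = Scale C c (ep \<cdot> peval p)"
    unfolding peval_smult point_alg_sel by (rule Comp_Scale_right[OF pe ep])
  then show "unit_coord (ep \<cdot> peval (smult c p)) = c * unit_coord (ep \<cdot> peval p)"
    using unit_coord_linear(2)[OF assms cl] by simp
qed

lemma gen_fun_eq: "gen_fun C A = Abs_fps (\<lambda>n. unit_coord (ep \<cdot> peval (monom 1 n)))"
proof (rule fps_ext)
  fix n
  have "xpow n \<cdot> u = peval (monom 1 n)" using xpow_peval[of n 1] by (simp add: peval_1)
  then show "fps_nth (gen_fun C A) n = fps_nth (Abs_fps (\<lambda>n. unit_coord (ep \<cdot> peval (monom 1 n)))) n"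
    by (simp add: fps_nth_gen_fun)
qed

end

section \<open>The generating functions of the two summands\<close>

theorem proposition2p6:
  fixes C :: "('o, 'm, 'k::field) ksmc"
    and A :: "('o, 'm) frobenius_data"
    and A1 :: "('k, 'm) module"
    and x0 e e' :: "'m"
    and U U1 U2 a b Q1 Q2 :: "'k poly"
  assumes "k_linear_symmetric_monoidal_category C"
    and "karoubian C"
    and "End_unit_is_scalars C"
    and "commutative_frobenius_algebra C A"
    and "A1 = point_alg C A"
    and "x0 = handle C A"
    and "vectorspace.fin_dim class_ring (A1\<lparr>carrier := generated_subalgebra A1 {x0}\<rparr>)"
    and "is_min_poly A1 x0 U"
    and "U = U1 * U2"
    and "lead_coeff U1 = 1"
    and "lead_coeff U2 = 1"
    and "coprime U1 U2"
    and "\<not> [:0, 1:] dvd U2"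
    and "a * U1 + b * U2 = 1"
    and "e = poly_eval A1 a x0 \<otimes>\<^bsub>A1\<^esub> poly_eval A1 U1 x0"
    and "e' = \<one>\<^bsub>A1\<^esub> \<ominus>\<^bsub>A1\<^esub> e"
    and "Q1 = reflect_poly U2"
    and "Q2 = reflect_poly U1"
  shows "(\<exists>!v. partial_fractions (gen_fun C A) Q1 Q2 (fst v) (snd v)) \<and>
    (\<exists>B r s. splits C (Fobj A) (mult_by C A e) B r s) \<and>
    (\<exists>B r s. splits C (Fobj A) (mult_by C A e') B r s) \<and>
    (\<forall>v1 v2. partial_fractions (gen_fun C A) Q1 Q2 v1 v2 \<longrightarrow>
      (\<forall>B r s. splits C (Fobj A) (mult_by C A e) B r s \<longrightarrow>
        commutative_frobenius_algebra C (summand C A e B r s) \<and>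
        gen_fun C (summand C A e B r s) = fps_of_poly v1 / fps_of_poly Q1) \<and>
      (\<forall>B r s. splits C (Fobj A) (mult_by C A e') B r s \<longrightarrow>
        commutative_frobenius_algebra C (summand C A e' B r s) \<and>
        gen_fun C (summand C A e' B r s) = fps_of_poly v2 / fps_of_poly Q2))"
proof -
  interpret frobenius_algebra C A
    using assms(1,4) by (simp add: frobenius_algebra_def frobenius_algebra_axioms_def)
  \<comment> \<open>Polynomials with sum \<open>1\<close> whose values at the handle are
    \<open>e\<close> and \<open>e'\<close>.\<close>
  let ?ga = "a * U1" and ?gb = "b * U2"
  let ?L = "\<lambda>q. unit_coord (Fcounit A \<cdot>\<^bsub>C\<^esub> peval q)"
  let ?F = "\<lambda>g. Abs_fps (\<lambda>n. ?L (monom 1 n * g))"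
  have U: "peval U = \<zero>\<^bsub>P\<^esub>" using assms(5,6,8) by (simp add: is_min_poly_def)
  have nz: "U1 \<noteq> 0" "U2 \<noteq> 0" using assms(10,11) by auto
  have U2_0: "coeff U2 0 \<noteq> 0"
    using assms(13) dvd_iff_poly_eq_0[of 0 U2] by (simp add: poly_0_coeff_0)
  have e: "e = peval ?ga"
    by (simp add: assms(5,6,15) point_alg_mult peval_mult)
  have "\<one>\<^bsub>P\<^esub> = peval ?gb \<oplus>\<^bsub>P\<^esub> peval ?ga"
    unfolding peval_add[symmetric] using assms(14) by (simp add: add.commute peval_1 point_alg_sel)
  then have e': "e' = peval ?gb"
    by (simp add: assms(5,16) e a_minus_def P.a_assoc P.r_neg)
  have idem: "peval (g * g) = peval g" if "U dvd g - g * g" for g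
  proof -
    have "peval ((g - g * g) + g * g) = \<zero>\<^bsub>P\<^esub> \<oplus>\<^bsub>P\<^esub> peval (g * g)"
      unfolding peval_add peval_multiple[OF U that] ..
    then show ?thesis by simp
  qed
  \<comment> \<open>Both differences equal \<open>?ga * ?gb = a * b * U\<close>, which vanishes at
    the handle.\<close>
  have "?ga - ?ga * ?ga = ?ga * (1 - ?ga)" "?gb - ?gb * ?gb = ?gb * (1 - ?gb)"
    by (simp_all add: algebra_simps)
  moreover have "1 - ?ga = ?gb" "1 - ?gb = ?ga" using assms(14) by (simp_all add: algebra_simps)
  ultimately have "U dvd ?ga - ?ga * ?ga" "U dvd ?gb - ?gb * ?gb"
    by (simp_all add: assms(9) mult_ac)
  then have idem_a: "peval (?ga * ?ga) = peval ?ga" and idem_b: "peval (?gb * ?gb) = peval ?gb"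
    using idem by blast+
  have L_zero: "?L q = 0" if "U dvd q" for q
    using peval_coord_linear(2)[OF assms(3), of 0 0] peval_multiple[OF U that] by simp
  \<comment> \<open>\<open>?ga * U2 = a * U\<close>, so the summand of \<open>e\<close> has
    characteristic polynomial \<open>U2\<close>.\<close>
  have "?L (monom 1 n * (?ga * U2)) = 0" for n
    by (rule L_zero, rule dvdI[of _ _ "monom 1 n * a"]) (simp add: assms(9) mult_ac)
  from linear_functional_recurrence[of ?L, OF peval_coord_linear[OF assms(3)] this]
  obtain v1 where v1: "?F ?ga * fps_of_poly Q1 = fps_of_poly v1" "v1 = 0 \<or> degree v1 < degree U2"
    unfolding assms(17) by blast
  have "?L (monom 1 n * (?gb * U1)) = 0" for n
    by (rule L_zero, rule dvdI[of _ _ "monom 1 n * b"]) (simp add: assms(9) mult_ac)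
  \<comment> \<open>The degree bound is dropped: if \<open>T\<close> divides \<open>U1\<close>, then
    \<open>Q2\<close> has smaller degree than \<open>U1\<close>, and the bound does not make the
    fraction proper.\<close>
  from linear_functional_recurrence[of ?L, OF peval_coord_linear[OF assms(3)] this]
  obtain v2 where v2: "?F ?gb * fps_of_poly Q2 = fps_of_poly v2"
    unfolding assms(18) by blast
  have Q: "fps_of_poly Q1 \<noteq> 0" "fps_of_poly Q2 \<noteq> 0"
    using nz by (simp_all add: assms(17,18))
  have F: "?F ?ga = fps_of_poly v1 / fps_of_poly Q1" "?F ?gb = fps_of_poly v2 / fps_of_poly Q2"
    using Q by (simp_all add: v1(1)[symmetric] v2[symmetric])
  have "gen_fun C A = ?F ?ga + ?F ?gb"
  proof (rule fps_ext)
    fix n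
    have "?L (monom 1 n) = ?L (monom 1 n * ?ga + monom 1 n * ?gb)"
      using assms(14) by (simp add: distrib_left[symmetric])
    then show "fps_nth (gen_fun C A) n = fps_nth (?F ?ga + ?F ?gb) n"
      by (simp add: gen_fun_eq peval_coord_linear[OF assms(3)])
  qed
  \<comment> \<open>Properness uses \<open>degree Q1 = degree U2\<close>, which holds since
    \<open>U2\<close> has nonzero constant term.\<close>
  then have pf: "partial_fractions (gen_fun C A) Q1 Q2 v1 v2"
    unfolding partial_fractions_def F using v1(2) U2_0 by (simp add: assms(17))
  have unique: "w1 = v1 \<and> w2 = v2" if "partial_fractions (gen_fun C A) Q1 Q2 w1 w2" for w1 w2
    using partial_fractions_unique[OF assms(14) nz(1) U2_0] that pf unfolding assms(17,18) by blast
  show ?thesis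
  proof (intro conjI allI impI)
    show "\<exists>!v. partial_fractions (gen_fun C A) Q1 Q2 (fst v) (snd v)"
    proof (rule ex1I[of _ "(v1, v2)"])
      show "v = (v1, v2)" if "partial_fractions (gen_fun C A) Q1 Q2 (fst v) (snd v)" for v
        using unique[OF that] by (simp add: prod_eq_iff)
    qed (use pf in simp)
    show "\<exists>B r s. splits C X (mult_by C A e) B r s" "\<exists>B r s. splits C X (mult_by C A e') B r s"
      unfolding e e' using splits_exists[OF assms(2)] idem_a idem_b by blast+
  next
    fix w1 w2 B r s
    assume "partial_fractions (gen_fun C A) Q1 Q2 w1 w2"
    then have w: "w1 = v1" "w2 = v2" using unique by blast+
    show "commutative_frobenius_algebra C (summand C A e B r s)"
      and "gen_fun C (summand C A e B r s) = fps_of_poly w1 / fps_of_poly Q1"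
      if "splits C X (mult_by C A e) B r s"
      using gen_fun_summand[OF idem_a that[unfolded e]] unfolding e w F .
    show "commutative_frobenius_algebra C (summand C A e' B r s)"
      and "gen_fun C (summand C A e' B r s) = fps_of_poly w2 / fps_of_poly Q2"
      if "splits C X (mult_by C A e') B r s"
      using gen_fun_summand[OF idem_b that[unfolded e']] unfolding e' w F .
  qed
qed

end
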